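(* Let $k$ be an even nonnegative integer, $\upsilon\in\{1,2,\dots\}$, $p>k+1$, $q>-1$, $w_1,w_2,\gamma_3,\sigma,\tau\in\mathbb{C}$ with $w_1\ne0$, $\operatorname{Re}(\sigma-p-1)>0$ and $\operatorname{Re}(\tau-q-1)>0$. Consider, for a given function $\psi$ on $(0,\infty)\times(0,\infty)$, the double convolution equation in the unknown $d$ $$\psi(z,t)=w_{1}^{k/2}\int_{0}^{z}\int_{0}^{t}(z-\xi)^{p+\frac k2}(t-y)^{q}\,d(\xi,y)\;{}_{K}I_{k;\upsilon}^{\left(p,q;\frac{-k+1}{2};p-k\right)}\left(\frac{1}{2\sqrt{w_{1}(z-\xi)}},w_{2}(t-y)\right)dy\,d\xi .$$ If ${}_{z}\mathbb{I}_{0^{+}}^{-\sigma}\,{}_{t}\mathbb{I}_{0^{+}}^{-\tau}\psi$ exists and is integrable for $0<z,t<\infty$, then the equation has the solution $$d(z,t)=\frac{(-1)^{k}}{(1-p)_{k}}\int_{0}^{z}\int_{0}^{t}(z-\xi)^{\sigma-p-2}(t-y)^{\tau-q-2}E_{\frac{k+1}{2},k,\gamma_{3};\sigma-p-1;\tau-q-1;\upsilon}^{(k;k;\gamma_{3})}(w_{1}(z-\xi),w_{2}(t-y))\;{}_{z}\mathbb{I}_{0^{+}}^{-\sigma}\,{}_{t}\mathbb{I}_{0^{+}}^{-\tau}\psi(\xi,y)\,dy\,d\xi .$$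
   Context: $(a)_n$ is the Pochhammer symbol, $[x]$ the integer part. The modified finite bivariate I-Konhauser polynomials are $${}_{K}I_{k;\upsilon}^{(p,q;\gamma;c)}(z,t)=(1-p)_{k}(-2z)^{k}\sum_{l=0}^{[k/2]}\sum_{n=0}^{k-l}\frac{(-1)^{l}(-k)_{2l}(-(k-l))_{n}(c)_{l}\left(\frac{1}{4z^{2}}\right)^{l}t^{\upsilon n}}{(p-k)_{l}(\gamma)_{l}\,\Gamma(p+1+l)\,\Gamma(q+1+\upsilon n)\,l!\,n!},$$ for $\gamma\notin\{0,-1,-2,\dots\}$, $p>k+1$, $q>-1$, $\upsilon=1,2,\dots$. The modified I-Konhauser Mittag-Leffler function is $$E_{\gamma_{4},\gamma_{5},\gamma_{6};p;q;\upsilon}^{(\gamma_{1};\gamma_{2};\gamma_{3})}(z,t)=\sum_{l=0}^{\infty}\sum_{n=0}^{\infty}\frac{(-1)^{l}(\gamma_{1})_{2l}(\gamma_{2})_{l+n}(\gamma_{3})_{l}\,z^{l}t^{\upsilon n}}{(\gamma_{4})_{l}(\gamma_{5})_{l}(\gamma_{6})_{l}\,\Gamma(p+l)\,\Gamma(q+\upsilon n)\,n!\,l!}.$$ When $\gamma_4=\frac{\gamma_1+1}{2}$, $\gamma_5=\gamma_2$, $\gamma_6=\gamma_3$, the equal parameters are understood to be cancelled before substituting values, i.e. $$E_{\frac{\gamma_{1}+1}{2},\gamma_{2},\gamma_{3};p;q;\upsilon}^{(\gamma_{1};\gamma_{2};\gamma_{3})}(z,t)=\sum_{l=0}^{\infty}\sum_{n=0}^{\infty}\frac{(-4)^{l}\left(\frac{\gamma_{1}}{2}\right)_{l}(\gamma_{2}+l)_{n}\,z^{l}t^{\upsilon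 n}}{\Gamma(p+l)\,\Gamma(q+\upsilon n)\,n!\,l!}.$$ The double Riemann-Liouville integral is $({}_{z}\mathbb{I}_{0^{+}}^{\sigma}\,{}_{t}\mathbb{I}_{0^{+}}^{\tau}g)(z,t)=\frac{1}{\Gamma(\sigma)\Gamma(\tau)}\int_0^t\int_0^z(z-\xi)^{\sigma-1}(t-y)^{\tau-1}g(\xi,y)\,d\xi\,dy$ for $\operatorname{Re}\sigma,\operatorname{Re}\tau>0$. The symbol ${}_{z}\mathbb{I}_{0^{+}}^{-\sigma}\,{}_{t}\mathbb{I}_{0^{+}}^{-\tau}\psi$ denotes the corresponding inverse operation: the function $g$ (when it exists) with ${}_{z}\mathbb{I}_{0^{+}}^{\sigma}\,{}_{t}\mathbb{I}_{0^{+}}^{\tau}g=\psi$, so that the double Laplace transforms satisfy $\mathbb{L}_2(g)(a,b)=a^{\sigma}b^{\tau}\mathbb{L}_2(\psi)(a,b)$. *)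

theory Defs
  imports "HOL-Analysis.Analysis"
begin

text \<open>
  Throughout, Gamma vanishes at its poles and division by zero yields zero, so a factor
  1/Gamma x is the entire reciprocal Gamma function.
\<close>

definition konhauser_I ::
    "nat \<Rightarrow> nat \<Rightarrow> real \<Rightarrow> real \<Rightarrow> complex \<Rightarrow> complex \<Rightarrow> complex \<Rightarrow> complex \<Rightarrow> complex" where
  "konhauser_I k \<upsilon> p q \<gamma> c z t =
     pochhammer (1 - of_real p) k * (- 2 * z) ^ k *
     (\<Sum>l = 0..k div 2. \<Sum>n = 0..k - l.
        ((-1) ^ l * pochhammer (- of_nat k) (2 * l) * pochhammer (- (of_nat k - of_nat l)) n *
         pochhammer c l * (1 / (4 * z ^ 2)) ^ l * t ^ (\<upsilon> * n)) /
        (pochhammer (of_real p - of_nat k) l * pochhammer \<gamma> l *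
         Gamma (of_real p + 1 + of_nat l) * Gamma (of_real q + 1 + of_nat (\<upsilon> * n)) *
         fact l * fact n))"

definition konhauser_ML_coeff ::
    "complex \<Rightarrow> complex \<Rightarrow> complex \<Rightarrow> complex \<Rightarrow> complex \<Rightarrow> complex \<Rightarrow> nat \<Rightarrow> nat \<Rightarrow> complex" where
  "konhauser_ML_coeff \<gamma>1 \<gamma>2 \<gamma>3 \<gamma>4 \<gamma>5 \<gamma>6 l n =
     (if \<gamma>4 = (\<gamma>1 + 1) / 2 \<and> \<gamma>5 = \<gamma>2 \<and> \<gamma>6 = \<gamma>3
      then (-4) ^ l * pochhammer (\<gamma>1 / 2) l * pochhammer (\<gamma>2 + of_nat l) n
      else (-1) ^ l * pochhammer \<gamma>1 (2 * l) * pochhammer \<gamma>2 (l + n) * pochhammer \<gamma>3 l /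
           (pochhammer \<gamma>4 l * pochhammer \<gamma>5 l * pochhammer \<gamma>6 l))"

text \<open>
  The first branch is the convention that equal parameters are cancelled before values are
  substituted; it matters when a Pochhammer symbol in the denominator vanishes (for instance
  when the second parameter is 0). Otherwise it agrees with the quotient in the second branch:
\<close>

lemma konhauser_ML_coeff_cancelled:
  assumes "pochhammer ((\<gamma>1 + 1) / 2) l \<noteq> 0" "pochhammer \<gamma>2 l \<noteq> 0" "pochhammer \<gamma>3 l \<noteq> 0"
  shows "konhauser_ML_coeff \<gamma>1 \<gamma>2 \<gamma>3 ((\<gamma>1 + 1) / 2) \<gamma>2 \<gamma>3 l n =
         (-1) ^ l * pochhammer \<gamma>1 (2 * l) * pochhammer \<gamma>2 (l + n) * pochhammer \<gamma>3 l /
         (pochhammer ((\<gamma>1 + 1) / 2) l * pochhammer \<gamma>2 l * pochhammer \<gamma>3 l)"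
proof -
  have "pochhammer \<gamma>1 (2 * l) = 4 ^ l * pochhammer (\<gamma>1 / 2) l * pochhammer ((\<gamma>1 + 1) / 2) l"
    using pochhammer_double[of "\<gamma>1 / 2" l] by (simp add: power_mult add_divide_distrib)
  moreover have "pochhammer \<gamma>2 (l + n) = pochhammer \<gamma>2 l * pochhammer (\<gamma>2 + of_nat l) n"
    by (rule pochhammer_product')
  moreover have "(-4 :: complex) ^ l = (-1) ^ l * 4 ^ l"
    by (simp flip: power_mult_distrib)
  ultimately show ?thesis
    using assms by (simp add: konhauser_ML_coeff_def)
qed

definition konhauser_ML ::
    "complex \<Rightarrow> complex \<Rightarrow> complex \<Rightarrow> complex \<Rightarrow> complex \<Rightarrow> complex \<Rightarrow>
     complex \<Rightarrow> complex \<Rightarrow> nat \<Rightarrow> complex \<Rightarrow> complex \<Rightarrow> complex" where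
  "konhauser_ML \<gamma>1 \<gamma>2 \<gamma>3 \<gamma>4 \<gamma>5 \<gamma>6 p q \<upsilon> z t =
     (\<Sum>l. \<Sum>n. konhauser_ML_coeff \<gamma>1 \<gamma>2 \<gamma>3 \<gamma>4 \<gamma>5 \<gamma>6 l n * z ^ l * t ^ (\<upsilon> * n) /
        (Gamma (p + of_nat l) * Gamma (q + of_nat (\<upsilon> * n)) * fact n * fact l))"

definition RL2_integrand ::
    "complex \<Rightarrow> complex \<Rightarrow> (real \<Rightarrow> real \<Rightarrow> complex) \<Rightarrow> real \<Rightarrow> real \<Rightarrow> real \<Rightarrow> real \<Rightarrow> complex" where
  "RL2_integrand \<sigma> \<tau> g z t \<xi> y =
     of_real (z - \<xi>) powr (\<sigma> - 1) * of_real (t - y) powr (\<tau> - 1) * g \<xi> y"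

definition RL2 ::
    "complex \<Rightarrow> complex \<Rightarrow> (real \<Rightarrow> real \<Rightarrow> complex) \<Rightarrow> real \<Rightarrow> real \<Rightarrow> complex" where
  "RL2 \<sigma> \<tau> g z t =
     1 / (Gamma \<sigma> * Gamma \<tau>) *
     (LINT y:{0<..<t}|lebesgue. LINT \<xi>:{0<..<z}|lebesgue. RL2_integrand \<sigma> \<tau> g z t \<xi> y)"

text \<open>
  The inverse of the double Riemann-Liouville integral is determined only up to null sets, so
  it is rendered as a relation between \<psi> and g. Since Isabelle assigns the value 0 to
  divergent integrals, convergence of the integral at every point is stated explicitly.
\<close>

definition is_RL2_inverse ::
    "complex \<Rightarrow> complex \<Rightarrow> (real \<Rightarrow> real \<Rightarrow> complex) \<Rightarrow> (real \<Rightarrow> real \<Rightarrow> complex) \<Rightarrow> bool" where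
  "is_RL2_inverse \<sigma> \<tau> \<psi> g \<longleftrightarrow>
     (\<forall>z>0. \<forall>t>0.
        (\<lambda>(\<xi>, y). RL2_integrand \<sigma> \<tau> g z t \<xi> y) absolutely_integrable_on {0<..<z} \<times> {0<..<t} \<and>
        RL2 \<sigma> \<tau> g z t = \<psi> z t)"

text \<open>
  The choice of the branch of the square root is immaterial for even k, since
  konhauser_I then depends only on the k-th power and on the square of its first argument.
\<close>

definition conv_integrand ::
    "nat \<Rightarrow> nat \<Rightarrow> real \<Rightarrow> real \<Rightarrow> complex \<Rightarrow> complex \<Rightarrow> (real \<Rightarrow> real \<Rightarrow> complex) \<Rightarrow>
     real \<Rightarrow> real \<Rightarrow> real \<Rightarrow> real \<Rightarrow> complex" where
  "conv_integrand k \<upsilon> p q w1 w2 d z t \<xi> y =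
     of_real (z - \<xi>) powr of_real (p + real k / 2) * of_real (t - y) powr of_real q * d \<xi> y *
     konhauser_I k \<upsilon> p q ((- of_nat k + 1) / 2) (of_real p - of_nat k)
       (1 / (2 * csqrt (w1 * of_real (z - \<xi>)))) (w2 * of_real (t - y))"

definition solves_conv_equation ::
    "nat \<Rightarrow> nat \<Rightarrow> real \<Rightarrow> real \<Rightarrow> complex \<Rightarrow> complex \<Rightarrow>
     (real \<Rightarrow> real \<Rightarrow> complex) \<Rightarrow> (real \<Rightarrow> real \<Rightarrow> complex) \<Rightarrow> bool" where
  "solves_conv_equation k \<upsilon> p q w1 w2 \<psi> d \<longleftrightarrow>
     (\<forall>z>0. \<forall>t>0.
        (\<lambda>(\<xi>, y). conv_integrand k \<upsilon> p q w1 w2 d z t \<xi> y)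
          absolutely_integrable_on {0<..<z} \<times> {0<..<t} \<and>
        \<psi> z t = w1 ^ (k div 2) *
          (LINT \<xi>:{0<..<z}|lebesgue. LINT y:{0<..<t}|lebesgue.
             conv_integrand k \<upsilon> p q w1 w2 d z t \<xi> y))"

definition solution_integrand ::
    "nat \<Rightarrow> nat \<Rightarrow> real \<Rightarrow> real \<Rightarrow> complex \<Rightarrow> complex \<Rightarrow> complex \<Rightarrow> complex \<Rightarrow> complex \<Rightarrow>
     (real \<Rightarrow> real \<Rightarrow> complex) \<Rightarrow> real \<Rightarrow> real \<Rightarrow> real \<Rightarrow> real \<Rightarrow> complex" where
  "solution_integrand k \<upsilon> p q w1 w2 \<gamma>3 \<sigma> \<tau> g z t \<xi> y =
     of_real (z - \<xi>) powr (\<sigma> - of_real p - 2) * of_real (t - y) powr (\<tau> - of_real q - 2) *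
     konhauser_ML (of_nat k) (of_nat k) \<gamma>3 ((of_nat k + 1) / 2) (of_nat k) \<gamma>3
       (\<sigma> - of_real p - 1) (\<tau> - of_real q - 1) \<upsilon>
       (w1 * of_real (z - \<xi>)) (w2 * of_real (t - y)) * g \<xi> y"

end

theory Submission
  imports Defs
begin

text \<open>
  Both the kernel of the equation and the kernel of its solution belong to one family
  \<open>K (\<kappa>, a, b)\<close> of functions on the open quadrant (\<open>konhauser_kernel\<close>),
  \<open>K (\<kappa>, a, b) (x, s) = \<Sum> l n. c\<^sub>\<kappa> (l, n) x powr (a - 1 + l) s powr (b - 1 + \<upsilon> n) / (\<Gamma> (a + l) \<Gamma> (b + \<upsilon> n))\<close>.
  Here \<open>c\<^sub>\<kappa>\<close> has the generating function
  \<open>(1 - Y) powr (- \<kappa>) * (1 - X / (1 - Y)) powr (- \<kappa> / 2)\<close>, with \<open>X\<close> and \<open>Y\<close> rescaled by \<open>- 4 w1\<close>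
  and \<open>w2 ^ \<upsilon>\<close>. Up to constants, the kernel of the equation is \<open>K (- k, p + 1, q + 1)\<close>
  (\<open>konhauser_kernel_eq_I\<close>), a terminating series, and the kernel of the solution is
  \<open>K (k, \<sigma> - p - 1, \<tau> - q - 1)\<close> (\<open>konhauser_kernel_eq_ML\<close>).

  Convolution adds all three parameters (\<open>konhauser_kernel_convolution\<close>): by the Beta integral
  the powers divided by Gamma values multiply like monomials, and the generating functions
  multiply because they are powers of a fixed function. On coefficients this is the
  Chu--Vandermonde identity, used twice. Hence the two kernels convolve to
  \<open>K (0, \<sigma>, \<tau>)\<close>, which is the kernel \<open>x powr (\<sigma> - 1) * s powr (\<tau> - 1) / (\<Gamma> \<sigma> \<Gamma> \<tau>)\<close> of the double
  Riemann--Liouville integral. If \<open>d\<close> is the convolution of the second kernel with \<open>g\<close>,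
  associativity makes the convolution of the first kernel with \<open>d\<close> the
  Riemann--Liouville integral of \<open>g\<close>, that is, \<open>\<psi>\<close>.

  The equation is to hold at every point, whereas convolutions of locally integrable functions
  exist only almost everywhere. Associativity is therefore applied at each fixed point \<open>(z, t)\<close>
  (\<open>convolution_assoc\<close>). On bounded sets the two kernels are bounded by multiples of the leading
  powers \<open>x powr p * s powr q\<close> and \<open>x powr (Re \<sigma> - p - 2) * s powr (Re \<tau> - q - 2)\<close>; these
  convolve to a multiple of \<open>x powr (Re \<sigma> - 1) * s powr (Re \<tau> - 1)\<close>, and the hypothesis on \<open>\<psi>\<close>
  provides integrability of \<open>g\<close> against exactly this weight. The same bound at the points \<open>(n, n)\<close>
  gives convergence of the integral defining \<open>d\<close> almost everywhere.
\<close>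

section \<open>Convolution of Riemann--Liouville kernels\<close>

lemma nn_integral_lborel_translate:
  fixes f :: "'a::euclidean_space \<Rightarrow> ennreal"
  assumes [measurable]: "f \<in> borel_measurable borel"
  shows "(\<integral>\<^sup>+x. f (x - c) \<partial>lborel) = (\<integral>\<^sup>+x. f x \<partial>lborel)"
proof -
  have "(\<integral>\<^sup>+x. f x \<partial>lborel) = (\<integral>\<^sup>+x. f x \<partial>distr lborel borel ((+) (- c)))"
    by (simp add: lborel_distr_plus)
  also have "\<dots> = (\<integral>\<^sup>+x. f (x - c) \<partial>lborel)"
    by (subst nn_integral_distr) auto
  finally show ?thesis by simp
qed

lemma integral_lborel_translate:
  fixes f :: "'a::euclidean_space \<Rightarrow> 'b::{banach,second_countable_topology}"
  assumes [measurable]: "f \<in> borel_measurable borel"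
  shows "(\<integral>x. f (x - c) \<partial>lborel) = (\<integral>x. f x \<partial>lborel)"
proof -
  have "(\<integral>x. f x \<partial>lborel) = (\<integral>x. f x \<partial>distr lborel borel ((+) (- c)))"
    by (simp add: lborel_distr_plus)
  also have "\<dots> = (\<integral>x. f (x - c) \<partial>lborel)"
    by (subst integral_distr) auto
  finally show ?thesis by simp
qed

lemma integrable_lborel_translate:
  fixes f :: "'a::euclidean_space \<Rightarrow> 'b::{banach,second_countable_topology}"
  assumes f: "integrable lborel f"
  shows "integrable lborel (\<lambda>x. f (x - c))"
proof -
  have [measurable]: "f \<in> borel_measurable borel" using f by auto
  have "integrable (distr lborel borel ((+) (- c))) f"
    using f by (simp add: lborel_distr_plus)
  then show ?thesis
    by (subst (asm) integrable_distr_eq) auto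
qed

lemma Gamma_nonzero_Re_pos:
  assumes "Re a > 0"
  shows "Gamma a \<noteq> 0"
  using assms by (auto simp: Gamma_eq_zero_iff elim!: nonpos_Ints_cases)

text \<open>
  The normalisation by the Gamma function makes the convolution of two kernels add their
  orders without producing a constant. The extension by zero lets the convolution integrals
  over bounded intervals be written as integrals over the whole line.
\<close>

definition rl_kernel :: "complex \<Rightarrow> real \<Rightarrow> complex" where
  "rl_kernel a x = (if x > 0 then of_real x powr (a - 1) / Gamma a else 0)"

definition pos_powr :: "real \<Rightarrow> real \<Rightarrow> real" where
  "pos_powr r x = (if x > 0 then x powr (r - 1) else 0)"

lemma rl_kernel_measurable [measurable]: "rl_kernel a \<in> borel_measurable borel"
proof -
  have "rl_kernel a = (\<lambda>x. if x > 0 then exp ((a - 1) * of_real (ln x)) / Gamma a else 0)"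
    by (auto simp: rl_kernel_def powr_def fun_eq_iff Ln_of_real)
  also have "\<dots> \<in> borel_measurable borel" by measurable
  finally show ?thesis .
qed

lemma pos_powr_measurable [measurable]: "pos_powr r \<in> borel_measurable borel"
  unfolding pos_powr_def by measurable

lemma pos_powr_nonneg [simp]: "pos_powr r x \<ge> 0"
  by (simp add: pos_powr_def)

lemma norm_rl_kernel: "norm (rl_kernel a x) = pos_powr (Re a) x / norm (Gamma a)"
  by (simp add: rl_kernel_def pos_powr_def norm_divide norm_powr_real_powr)

text \<open>
  The real Beta integral, rescaled from the unit interval to \<open>(0, x)\<close>. All absolute
  convergence arguments below rest on it, since the modulus of \<open>x powr (a - 1)\<close> is
  \<open>x powr (Re a - 1)\<close>.
\<close>

lemma nn_integral_pos_powr_convolution: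
  assumes "a > 0" "b > 0"
  shows "(\<integral>\<^sup>+\<xi>. ennreal (pos_powr a (x - \<xi>) * pos_powr b \<xi>) \<partial>lborel)
           = ennreal (Beta a b * pos_powr (a + b) x)"
proof (cases "x > 0")
  case False
  then have "(\<lambda>\<xi>. ennreal (pos_powr a (x - \<xi>) * pos_powr b \<xi>)) = (\<lambda>_. 0)"
    by (auto simp: pos_powr_def fun_eq_iff)
  then have "(\<integral>\<^sup>+\<xi>. ennreal (pos_powr a (x - \<xi>) * pos_powr b \<xi>) \<partial>lborel) = 0"
    by (simp only:) simp
  then show ?thesis using False by (simp add: pos_powr_def)
next
  case True
  have B: "0 \<le> Beta a b" using assms
    by (simp add: Beta_def Gamma_real_pos less_imp_le)
  have *: "pos_powr a (x - x * t) * pos_powr b (x * t)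
          = x powr (a + b - 2) * (indicator {0<..<1} t * (t powr (b - 1) * (1 - t) powr (a - 1)))" for t
  proof (cases "t \<in> {0<..<1}")
    case t: True
    have "pos_powr a (x * (1 - t)) = x powr (a - 1) * (1 - t) powr (a - 1)"
      using t True by (simp add: pos_powr_def powr_mult)
    moreover have "pos_powr b (x * t) = x powr (b - 1) * t powr (b - 1)"
      using t True by (simp add: pos_powr_def powr_mult)
    moreover have "x powr (a + b - 2) = x powr (a - 1) * x powr (b - 1)"
      by (simp flip: powr_add)
    ultimately show ?thesis using t by (simp add: right_diff_distrib)
  next
    case t: False
    with True have "x * t \<le> 0 \<or> x - x * t \<le> 0"
      by (auto simp: mult_le_0_iff not_less)
    then show ?thesis using t by (auto simp: pos_powr_def)
  qed
  have "((\<lambda>t. t powr (b - 1) * (1 - t) powr (a - 1)) has_integral Beta b a) {0<..<1}"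
    using has_integral_Beta_real[of b a] assms by (simp add: has_integral_Icc_iff_Ioo)
  then have "(\<integral>\<^sup>+t. ennreal (indicator {0<..<1} t * (t powr (b - 1) * (1 - t) powr (a - 1))) \<partial>lborel)
      = ennreal (Beta a b)"
    by (intro nn_integral_has_integral_lebesgue[THEN trans]) (auto simp: Beta_commute)
  note beta = this
  have "(\<integral>\<^sup>+\<xi>. ennreal (pos_powr a (x - \<xi>) * pos_powr b \<xi>) \<partial>lborel)
      = x * (\<integral>\<^sup>+t. ennreal (pos_powr a (x - x * t) * pos_powr b (x * t)) \<partial>lborel)"
    using True nn_integral_real_affine[of "\<lambda>\<xi>. ennreal (pos_powr a (x - \<xi>) * pos_powr b \<xi>)" x 0]
    by simp
  also have "\<dots> = x * (x powr (a + b - 2) * ennreal (Beta a b))"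
    unfolding * by (subst ennreal_mult') (simp_all add: nn_integral_cmult beta)
  also have "\<dots> = ennreal (x * x powr (a + b - 2) * Beta a b)"
    using True B by (simp add: ennreal_mult mult.assoc)
  also have "x * x powr (a + b - 2) = pos_powr (a + b) x"
    using True powr_add[of x 1 "a + b - 2"] by (simp add: pos_powr_def)
  finally show ?thesis by (simp add: mult.commute)
qed

lemma integrable_rl_kernel_product:
  assumes "Re a > 0" "Re b > 0"
  shows "integrable lborel (\<lambda>\<xi>. rl_kernel a (x - \<xi>) * rl_kernel b \<xi>)"
proof (rule integrableI_bounded)
  have "(\<integral>\<^sup>+\<xi>. ennreal (norm (rl_kernel a (x - \<xi>) * rl_kernel b \<xi>)) \<partial>lborel)
     = (\<integral>\<^sup>+\<xi>. ennreal (1 / (norm (Gamma a) * norm (Gamma b))) * 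
          ennreal (pos_powr (Re a) (x - \<xi>) * pos_powr (Re b) \<xi>) \<partial>lborel)"
    by (intro nn_integral_cong) (simp add: norm_mult norm_rl_kernel flip: ennreal_mult)
  also have "\<dots> < \<infinity>"
    by (subst nn_integral_cmult)
       (auto simp: nn_integral_pos_powr_convolution[OF assms] ennreal_mult_less_top)
  finally show "(\<integral>\<^sup>+\<xi>. ennreal (norm (rl_kernel a (x - \<xi>) * rl_kernel b \<xi>)) \<partial>lborel) < \<infinity>" .
qed auto

text \<open>
  Euler's integral: the Laplace transform of the kernel, evaluated at 1.
\<close>

lemma has_bochner_integral_rl_kernel_exp:
  assumes "Re a > 0"
  shows "has_bochner_integral lborel (\<lambda>x. rl_kernel a x * exp (- of_real x)) 1"
proof -
  have G: "Gamma a \<noteq> 0"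
    by (rule Gamma_nonzero_Re_pos) fact
  have eq: "rl_kernel a x * exp (- of_real x)
      = indicator {0<..} x *\<^sub>R (of_real x powr (a - 1) / of_real (exp x)) / Gamma a" for x
    by (simp add: rl_kernel_def exp_minus field_simps indicator_def exp_of_real)
  have int: "integrable lborel (\<lambda>x. rl_kernel a x * exp (- of_real x))"
  proof -
    have "set_integrable lebesgue {0<..} (\<lambda>t. complex_of_real t powr (a - 1) / of_real (exp t))"
      using absolutely_integrable_Gamma_integral[OF assms zero_less_one] by simp
    then have "integrable lebesgue (\<lambda>x. rl_kernel a x * exp (- of_real x))"
      unfolding eq set_integrable_def by simp
    then show ?thesis by (subst (asm) integrable_completion) auto
  qed
  have "((\<lambda>x. rl_kernel a x * exp (- of_real x)) has_integral 
           (\<integral>x. rl_kernel a x * exp (- of_real x) \<partial>lborel)) UNIV"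
    by (rule has_integral_integral_lborel[OF int])
  moreover have "((\<lambda>x. rl_kernel a x * exp (- of_real x)) has_integral 1) UNIV"
  proof -
    have "((\<lambda>t. of_real t powr (a - 1) / of_real (exp t)) has_integral Gamma a) {0<..}"
      by (rule has_integral_spike_set_eq[THEN iffD1, OF _ _ Gamma_integral_complex[OF assms]])
         (auto intro!: negligible_subset[OF negligible_sing[of 0]])
    then have "((\<lambda>t. of_real t powr (a - 1) / of_real (exp t) / Gamma a) has_integral Gamma a / Gamma a) {0<..}"
      by (rule has_integral_divide)
    then have "((\<lambda>t. if t \<in> {0<..} then of_real t powr (a - 1) / of_real (exp t) / Gamma a else 0) has_integral 1) UNIV"
      unfolding has_integral_restrict_UNIV using G by simp
    then show ?thesis
      by (rule has_integral_eq[rotated]) (auto simp: eq)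
  qed
  ultimately have "(\<integral>x. rl_kernel a x * exp (- of_real x) \<partial>lborel) = 1"
    by (rule has_integral_unique)
  with int show ?thesis by (simp add: has_bochner_integral_iff)
qed

text \<open>
  The Beta integral for complex orders. By scaling, the convolution is a constant multiple of
  the kernel of order \<open>a + b\<close>. The constant is found by taking Laplace transforms at 1: the
  transform of a convolution is a product, and each kernel has transform 1.
\<close>

lemma rl_kernel_convolution:
  assumes a: "Re a > 0" and b: "Re b > 0"
  shows "(\<integral>\<xi>. rl_kernel a (x - \<xi>) * rl_kernel b \<xi> \<partial>lborel) = rl_kernel (a + b) x"
proof -
  define I where "I x = (\<integral>\<xi>. rl_kernel a (x - \<xi>) * rl_kernel b \<xi> \<partial>lborel)" for x
  define E where "E a x = rl_kernel a x * exp (- of_real x)" for a x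
  have [measurable]: "E a \<in> borel_measurable borel" for a unfolding E_def by measurable
  have E: "integrable lborel (E a)" "integral\<^sup>L lborel (E a) = 1" if "Re a > 0" for a
    using has_bochner_integral_rl_kernel_exp[OF that] by (simp_all add: has_bochner_integral_iff E_def[abs_def])
  have nz: "Gamma (a + b) \<noteq> 0"
    by (rule Gamma_nonzero_Re_pos) (use a b in simp)
  \<comment> \<open>homogeneity: the substitution \<open>\<xi> = x t\<close> reduces the convolution to its value at 1\<close>
  have scale: "I x = I 1 * Gamma (a + b) * rl_kernel (a + b) x" for x
  proof (cases "x > 0")
    case False
    then have "(\<lambda>\<xi>. rl_kernel a (x - \<xi>) * rl_kernel b \<xi>) = (\<lambda>_. 0)"
      by (auto simp: rl_kernel_def fun_eq_iff)
    then have "I x = 0" unfolding I_def by (simp only:) simp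
    with False show ?thesis by (simp add: rl_kernel_def)
  next
    case True
    have h: "rl_kernel c (x * t) = of_real x powr (c - 1) * rl_kernel c t" for c t
      using True by (simp add: rl_kernel_def zero_less_mult_iff powr_times_real)
    have "I x = x *\<^sub>R (\<integral>t. rl_kernel a (x - x * t) * rl_kernel b (x * t) \<partial>lborel)"
      unfolding I_def using True lborel_integral_real_affine[of x "\<lambda>\<xi>. rl_kernel a (x - \<xi>) * rl_kernel b \<xi>" 0]
      by simp
    also have "(\<lambda>t. rl_kernel a (x - x * t) * rl_kernel b (x * t))
        = (\<lambda>t. (of_real x powr (a - 1) * of_real x powr (b - 1)) * (rl_kernel a (1 - t) * rl_kernel b t))"
      using h[of a "1 - _"] h[of b] by (simp add: right_diff_distrib mult_ac)
    also have "(\<integral>t. (of_real x powr (a - 1) * of_real x powr (b - 1)) * (rl_kernel a (1 - t) * rl_kernel b t) \<partial>lborel)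
        = of_real x powr (a - 1) * of_real x powr (b - 1) * I 1"
      unfolding I_def by simp
    finally have "I x = (of_real x powr 1 * of_real x powr (a - 1) * of_real x powr (b - 1)) * I 1"
      using True by (simp add: scaleR_conv_of_real)
    also have "of_real x powr 1 * of_real x powr (a - 1) * of_real x powr (b - 1) = complex_of_real x powr (a + b - 1)"
      by (simp only: powr_add [symmetric]) (simp add: algebra_simps)
    finally show ?thesis using True nz by (simp add: rl_kernel_def)
  qed
  \<comment> \<open>integrating \<open>F\<close> in the two orders computes the Laplace transform of the convolution twice\<close>
  define F where "F \<xi> x = E b \<xi> * E a (x - \<xi>)" for \<xi> x
  have F: "F \<xi> x = exp (- of_real x) * (rl_kernel a (x - \<xi>) * rl_kernel b \<xi>)" for \<xi> x
    by (simp add: F_def E_def mult_ac flip: exp_add)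
  have int: "integrable (lborel \<Otimes>\<^sub>M lborel) (case_prod F)"
  proof (rule lborel_pair.Fubini_integrable)
    show "case_prod F \<in> borel_measurable (lborel \<Otimes>\<^sub>M lborel)"
      unfolding F_def by measurable
    have "(\<integral>x. norm (case_prod F (\<xi>, x)) \<partial>lborel) = norm (E b \<xi>) * (\<integral>x. norm (E a x) \<partial>lborel)" for \<xi>
      using integral_lborel_translate[of "\<lambda>x. norm (E a x)" \<xi>] by (simp add: F_def norm_mult)
    then show "integrable lborel (\<lambda>\<xi>. \<integral>x. norm (case_prod F (\<xi>, x)) \<partial>lborel)"
      using E(1)[OF b] by simp
    show "AE \<xi> in lborel. integrable lborel (\<lambda>x. case_prod F (\<xi>, x))"
      using integrable_lborel_translate[OF E(1)[OF a]] by (simp add: F_def)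
  qed
  have "(\<integral>\<xi>. (\<integral>x. F \<xi> x \<partial>lborel) \<partial>lborel) = (\<integral>\<xi>. E b \<xi> \<partial>lborel)"
    using integral_lborel_translate[of "E a"] E(2)[OF a] by (simp add: F_def)
  also have "\<dots> = 1" using E(2)[OF b] .
  finally have "1 = (\<integral>x. (\<integral>\<xi>. F \<xi> x \<partial>lborel) \<partial>lborel)"
    using lborel_pair.Fubini_integral[OF int] by simp
  also have "\<dots> = (\<integral>x. I 1 * Gamma (a + b) * E (a + b) x \<partial>lborel)"
  proof (intro Bochner_Integration.integral_cong refl)
    fix x
    have "(\<integral>\<xi>. F \<xi> x \<partial>lborel) = exp (- of_real x) * I x"
      unfolding F I_def by simp
    then show "(\<integral>\<xi>. F \<xi> x \<partial>lborel) = I 1 * Gamma (a + b) * E (a + b) x"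
      by (simp only: scale[of x] E_def mult_ac)
  qed
  also have "\<dots> = I 1 * Gamma (a + b)"
    using E(2)[of "a + b"] a b by simp
  finally have "I 1 * Gamma (a + b) = 1" by simp
  with scale[of x] show ?thesis by (simp add: I_def)
qed

lemma integral_lborel_product:
  fixes f g :: "real \<Rightarrow> complex"
  assumes f: "integrable lborel f" and g: "integrable lborel g"
  shows "integrable lborel (\<lambda>(x, y). f x * g y)"
    and "(\<integral>(x, y). f x * g y \<partial>lborel) = integral\<^sup>L lborel f * integral\<^sup>L lborel g"
proof -
  have int: "integrable (lborel \<Otimes>\<^sub>M lborel) (\<lambda>(x, y). f x * g y)"
  proof (rule lborel_pair.Fubini_integrable)
    have [measurable]: "f \<in> borel_measurable borel" "g \<in> borel_measurable borel"
      using f g by auto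
    show "(\<lambda>(x, y). f x * g y) \<in> borel_measurable (lborel \<Otimes>\<^sub>M lborel)"
      by measurable
    show "integrable lborel (\<lambda>x. \<integral>y. norm (case (x, y) of (x, y) \<Rightarrow> f x * g y) \<partial>lborel)"
      using f by (simp add: norm_mult)
    show "AE x in lborel. integrable lborel (\<lambda>y. case (x, y) of (x, y) \<Rightarrow> f x * g y)"
      using g by simp
  qed
  then show "integrable lborel (\<lambda>(x, y). f x * g y)"
    by (simp add: lborel_prod)
  have "(\<integral>x. (\<integral>y. f x * g y \<partial>lborel) \<partial>lborel) = (\<integral>(x, y). f x * g y \<partial>(lborel \<Otimes>\<^sub>M lborel))"
    by (rule lborel_pair.integral_fst[OF int])
  then show "(\<integral>(x, y). f x * g y \<partial>lborel) = integral\<^sup>L lborel f * integral\<^sup>L lborel g"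
    by (simp add: lborel_prod)
qed

text \<open>
  Kernels and majorants in two variables are products of those in one variable, so that their
  convolutions over the plane factor.
\<close>

definition bi_rl :: "complex \<Rightarrow> complex \<Rightarrow> real \<times> real \<Rightarrow> complex" where
  "bi_rl a b u = rl_kernel a (fst u) * rl_kernel b (snd u)"

definition bi_pos :: "real \<Rightarrow> real \<Rightarrow> real \<times> real \<Rightarrow> real" where
  "bi_pos a b u = pos_powr a (fst u) * pos_powr b (snd u)"

lemma bi_rl_measurable [measurable]: "bi_rl a b \<in> borel_measurable borel"
  unfolding bi_rl_def borel_prod [symmetric] by measurable

lemma bi_pos_measurable [measurable]: "bi_pos a b \<in> borel_measurable borel"
  unfolding bi_pos_def borel_prod [symmetric] by measurable

lemma bi_pos_nonneg [simp]: "bi_pos a b u \<ge> 0"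
  by (simp add: bi_pos_def)

lemma bi_rl_convolution:
  assumes "Re a > 0" "Re b > 0" "Re a' > 0" "Re b' > 0"
  shows "(\<integral>v. bi_rl a b (u - v) * bi_rl a' b' v \<partial>lborel) = bi_rl (a + a') (b + b') u"
proof -
  have "(\<integral>v. bi_rl a b (u - v) * bi_rl a' b' v \<partial>lborel) =
        (\<integral>(\<xi>, y). (rl_kernel a (fst u - \<xi>) * rl_kernel a' \<xi>) *
                  (rl_kernel b (snd u - y) * rl_kernel b' y) \<partial>lborel)"
    by (intro Bochner_Integration.integral_cong) (auto simp: bi_rl_def mult_ac)
  also have "\<dots> = bi_rl (a + a') (b + b') u"
    using assms
    by (subst integral_lborel_product)
       (simp_all add: integrable_rl_kernel_product rl_kernel_convolution bi_rl_def)
  finally show ?thesis .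
qed

lemma nn_integral_bi_pos_convolution:
  assumes "a > 0" "b > 0" "a' > 0" "b' > 0"
  shows "(\<integral>\<^sup>+v. ennreal (bi_pos a b (u - v) * bi_pos a' b' v) \<partial>lborel)
       = ennreal (Beta a a' * Beta b b' * bi_pos (a + a') (b + b') u)"
proof -
  have B: "Beta a a' \<ge> 0" "Beta b b' \<ge> 0"
    using assms by (simp_all add: Beta_def Gamma_real_pos less_imp_le)
  have "(\<integral>\<^sup>+v. ennreal (bi_pos a b (u - v) * bi_pos a' b' v) \<partial>lborel) =
        (\<integral>\<^sup>+v. ennreal (bi_pos a b (u - v) * bi_pos a' b' v) \<partial>(lborel \<Otimes>\<^sub>M lborel))"
    by (simp add: lborel_prod)
  also have "\<dots> = (\<integral>\<^sup>+\<xi>. \<integral>\<^sup>+y. ennreal (pos_powr a (fst u - \<xi>) * pos_powr a' \<xi>) *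
                  ennreal (pos_powr b (snd u - y) * pos_powr b' y) \<partial>lborel \<partial>lborel)"
    by (subst lborel.nn_integral_fst[symmetric], simp add: lborel_prod)
       (auto intro!: nn_integral_cong simp: bi_pos_def mult_ac simp flip: ennreal_mult)
  also have "\<dots> = ennreal (Beta a a' * pos_powr (a + a') (fst u)) *
                  ennreal (Beta b b' * pos_powr (b + b') (snd u))"
    using assms
    by (simp add: nn_integral_cmult nn_integral_multc nn_integral_pos_powr_convolution)
  also have "\<dots> = ennreal (Beta a a' * Beta b b' * bi_pos (a + a') (b + b') u)"
    using B by (simp add: bi_pos_def mult_ac flip: ennreal_mult)
  finally show ?thesis .
qed

lemma integrable_bi_pos_product:
  assumes "a > 0" "b > 0" "a' > 0" "b' > 0"
  shows "integrable lborel (\<lambda>v. bi_pos a b (u - v) * bi_pos a' b' v)"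
  by (rule integrableI_bounded)
     (simp_all add: nn_integral_bi_pos_convolution[OF assms])

text \<open>
  Termwise integration over an arbitrary countable index set. One integrable weight \<open>w\<close>
  controls every term up to a summable factor, which gives both the absolute convergence of the
  series at each point and the summability of the integrated norms.
\<close>

lemma has_sum_integral_dominated:
  fixes f :: "'i::countable \<Rightarrow> 'a \<Rightarrow> 'b::{banach,second_countable_topology}"
  assumes [measurable]: "\<And>i. f i \<in> borel_measurable M"
    and bound: "\<And>i v. norm (f i v) \<le> C i * w v"
    and w: "integrable M w" and C: "C summable_on UNIV"
    and nonneg: "\<And>v. w v \<ge> 0" "\<And>i. C i \<ge> 0"
  shows "((\<lambda>i. integral\<^sup>L M (f i)) has_sum (\<integral>v. (\<Sum>\<^sub>\<infinity>i. f i v) \<partial>M)) UNIV"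
proof -
  \<comment> \<open>the index set is embedded into the natural numbers and the family extended by zero\<close>
  define g where "g n = (if n \<in> range (to_nat :: 'i \<Rightarrow> nat) then f (from_nat n) else (\<lambda>_. 0))" for n
  define D where "D n = (if n \<in> range (to_nat :: 'i \<Rightarrow> nat) then C (from_nat n) else 0)" for n
  have to_nat: "(h has_sum s) (UNIV :: 'i set) \<longleftrightarrow> 
      ((\<lambda>n. if n \<in> range (to_nat :: 'i \<Rightarrow> nat) then h (from_nat n) else 0) has_sum s) UNIV"
    for h :: "'i \<Rightarrow> 'c::{topological_space,comm_monoid_add}" and s
  proof -
    have "(h has_sum s) UNIV \<longleftrightarrow> ((h \<circ> from_nat) has_sum s) (range (to_nat :: 'i \<Rightarrow> nat))"
      by (subst has_sum_reindex) (auto simp: o_def)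
    also have "\<dots> \<longleftrightarrow> ((\<lambda>n. if n \<in> range (to_nat :: 'i \<Rightarrow> nat) then h (from_nat n) else 0) has_sum s) UNIV"
      by (rule has_sum_cong_neutral) auto
    finally show ?thesis .
  qed
  have [measurable]: "g n \<in> borel_measurable M" for n unfolding g_def by auto
  have gD: "norm (g n v) \<le> D n * w v" for n v using bound by (auto simp: g_def D_def)
  have D: "summable D"
    using C to_nat[of C] unfolding D_def summable_on_def by (auto intro: sums_summable has_sum_imp_sums)
  have D0: "D n \<ge> 0" for n using nonneg by (auto simp: D_def)
  have Dw: "summable (\<lambda>n. D n * z)" for z by (rule summable_mult2[OF D])
  have sum1: "summable (\<lambda>n. norm (g n v))" for v
    by (rule summable_comparison_test'[OF Dw]) (use gD in auto)
  have int: "integrable M (g n)" for n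
    by (rule Bochner_Integration.integrable_bound[of M "\<lambda>v. D n * w v"])
       (use w gD D0 nonneg in \<open>auto intro!: AE_I2\<close>)
  have nint: "(\<integral>v. norm (g n v) \<partial>M) \<le> D n * (\<integral>v. w v \<partial>M)" for n
  proof -
    have "(\<integral>v. norm (g n v) \<partial>M) \<le> (\<integral>v. D n * w v \<partial>M)"
      by (rule integral_mono) (use int w gD in auto)
    then show ?thesis by simp
  qed
  have sum2: "summable (\<lambda>n. \<integral>v. norm (g n v) \<partial>M)"
    by (rule summable_comparison_test'[OF Dw[of "\<integral>v. w v \<partial>M"]]) (use nint in auto)
  have "(\<lambda>n. integral\<^sup>L M (g n)) sums (\<integral>v. (\<Sum>n. g n v) \<partial>M)"
    by (rule sums_integral) (use int sum1 sum2 in auto)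
  moreover have "(\<Sum>n. g n v) = (\<Sum>\<^sub>\<infinity>i. f i v)" for v
  proof -
    have "((\<lambda>n. g n v) has_sum (\<Sum>n. g n v)) UNIV"
      using norm_summable_imp_has_sum[OF sum1] summable_sums[OF summable_norm_cancel[OF sum1]] by blast
    then have "((\<lambda>i. f i v) has_sum (\<Sum>n. g n v)) UNIV"
      unfolding to_nat g_def by (rule has_sum_cong[THEN iffD1, rotated]) auto
    then show ?thesis by (simp add: infsumI)
  qed
  moreover have "summable (\<lambda>n. norm (integral\<^sup>L M (g n)))"
    by (rule summable_comparison_test'[OF sum2]) auto
  ultimately have "((\<lambda>n. integral\<^sup>L M (g n)) has_sum (\<integral>v. (\<Sum>\<^sub>\<infinity>i. f i v) \<partial>M)) UNIV"
    by (simp add: norm_summable_imp_has_sum)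
  then show ?thesis
    unfolding to_nat g_def by (rule has_sum_cong[THEN iffD1, rotated]) auto
qed

lemma summable_on_product_nonneg:
  fixes f :: "'a \<Rightarrow> real" and g :: "'b \<Rightarrow> real"
  assumes "f summable_on A" "g summable_on B" "\<And>x. f x \<ge> 0" "\<And>x. g x \<ge> 0"
  shows "(\<lambda>(x, y). f x * g y) summable_on (A \<times> B)"
proof -
  have "(\<lambda>u. norm (case u of (x, y) \<Rightarrow> f x * g y)) summable_on (A \<times> B)"
    using assms
    by (subst Infinite_Sum.abs_summable_on_Sigma_iff)
       (auto simp: infsum_cmult_right' abs_mult infsum_nonneg intro!: summable_on_cmult_right summable_on_cmult_left)
  then show ?thesis by (rule abs_summable_summable)
qed

text \<open>
  The reciprocal Gamma function decays factorially along \<open>a, a + 1, a + 2, \<dots>\<close>. This beats the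
  geometric growth of the coefficients below and makes the double series entire.
\<close>

lemma inverse_Gamma_growth:
  assumes "Re a > 0"
  shows "\<exists>K E. K \<ge> 0 \<and> E \<ge> 1 \<and> (\<forall>m. 1 / norm (Gamma (a + of_nat m)) \<le> K * E ^ m / fact m)"
proof -
  define e where "e = min (Re a) 1"
  have e: "e > 0" "e \<le> 1" "e \<le> Re a" using assms by (auto simp: e_def)
  have G: "Gamma a \<noteq> 0" using assms by (rule Gamma_nonzero_Re_pos)
  \<comment> \<open>each factor satisfies \<open>\<bar>a + j\<bar> \<ge> Re a + j \<ge> e (1 + j)\<close> because \<open>e = min (Re a) 1\<close>\<close>
  have step: "norm (pochhammer a m) \<ge> e ^ m * fact m" for m
  proof (induction m)
    case (Suc m)
    have "e * (real m + 1) \<le> Re a + real m"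
      using e by (simp add: distrib_left) (smt (verit) mult_left_le_one_le of_nat_0_le_iff)
    also have "\<dots> \<le> norm (a + of_nat m)"
      using complex_Re_le_cmod[of "a + of_nat m"] by simp
    finally have "(e ^ m * fact m) * (e * (real m + 1)) \<le> norm (pochhammer a m) * norm (a + of_nat m)"
      using e by (intro mult_mono Suc) auto
    then show ?case by (simp add: pochhammer_Suc norm_mult mult_ac add.commute)
  qed auto
  have "1 / norm (Gamma (a + of_nat m)) \<le> (1 / norm (Gamma a)) * (1 / e) ^ m / fact m" for m
  proof -
    have Gam: "Gamma (a + of_nat m) = Gamma a * pochhammer a m"
    proof -
      have "a \<notin> \<int>\<^sub>\<le>\<^sub>0" using assms by (auto elim!: nonpos_Ints_cases)
      from pochhammer_Gamma[OF this, of m] G show ?thesis by simp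
    qed
    have pos: "0 < e ^ m * fact m" using e by simp
    have "1 / norm (Gamma (a + of_nat m)) = 1 / norm (Gamma a) * (1 / norm (pochhammer a m))"
      using Gam by (simp add: norm_mult)
    also have "\<dots> \<le> 1 / norm (Gamma a) * (1 / (e ^ m * fact m))"
      by (intro mult_left_mono divide_left_mono step mult_pos_pos pos less_le_trans[OF pos step]) auto
    finally show ?thesis by (simp add: power_one_over field_simps)
  qed
  then show ?thesis using e by (intro exI[of _ "1 / norm (Gamma a)"] exI[of _ "1 / e"]) auto
qed

section \<open>The semigroup of Konhauser kernels\<close>

text \<open>
  The Chu--Vandermonde identity, as the Cauchy product of \<open>(1 - X) powr (- a)\<close> and
  \<open>(1 - X) powr (- b)\<close>.
\<close>

lemma sum_pochhammer_div_fact: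
  fixes a b :: "'a::field_char_0"
  shows "(\<Sum>j\<le>n. pochhammer a j / fact j * (pochhammer b (n - j) / fact (n - j)))
       = pochhammer (a + b) n / fact n"
proof -
  have "pochhammer (a + b) n / fact n =
        (\<Sum>j\<le>n. of_nat (n choose j) * pochhammer a j * pochhammer b (n - j) / fact n)"
    by (subst pochhammer_binomial_sum) (rule sum_divide_distrib)
  also have "\<dots> = (\<Sum>j\<le>n. pochhammer a j / fact j * (pochhammer b (n - j) / fact (n - j)))"
    by (intro sum.cong) (auto simp: binomial_fact)
  finally show ?thesis by simp
qed

text \<open>
  The numbers \<open>(\<kappa>/2)\<^sub>l (\<kappa> + l)\<^sub>n / (l! n!)\<close> are the Taylor coefficients of
  \<open>(1 - Y) powr (- \<kappa>) * (1 - X / (1 - Y)) powr (- \<kappa> / 2)\<close>. With \<open>x = - 4 w1\<close> and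
  \<open>y = w2 ^ \<upsilon>\<close> the parameter \<open>\<kappa> = k\<close> gives the coefficients of the Mittag-Leffler function, and
  \<open>\<kappa> = - k\<close> those of the Konhauser polynomial.
\<close>

definition konhauser_coeff :: "complex \<Rightarrow> complex \<Rightarrow> complex \<Rightarrow> nat \<times> nat \<Rightarrow> complex" where
  "konhauser_coeff x y \<kappa> = (\<lambda>(l, n).
     x ^ l * y ^ n * (pochhammer (\<kappa> / 2) l / fact l) * (pochhammer (\<kappa> + of_nat l) n / fact n))"

text \<open>
  The generating function with parameter \<open>\<kappa>\<close> is a power with exponent proportional to \<open>\<kappa>\<close>, so
  a product of two of them adds the parameters. On coefficients, the inner sum over \<open>n\<close> is a
  Vandermonde sum whose value \<open>(\<kappa> + \<mu> + L)\<^sub>N / N!\<close> does not depend on \<open>l\<close>, and the remaining sum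
  over \<open>l\<close> is a second Vandermonde sum.
\<close>

lemma konhauser_coeff_convolution:
  "(\<Sum>(l, n)\<in>{..L} \<times> {..N}. konhauser_coeff x y \<kappa> (l, n) * konhauser_coeff x y \<mu> (L - l, N - n))
     = konhauser_coeff x y (\<kappa> + \<mu>) (L, N)"
proof -
  have "(\<Sum>(l, n)\<in>{..L} \<times> {..N}. konhauser_coeff x y \<kappa> (l, n) * konhauser_coeff x y \<mu> (L - l, N - n))
      = (\<Sum>l\<le>L. x ^ L * y ^ N *
           (pochhammer (\<kappa> / 2) l / fact l * (pochhammer (\<mu> / 2) (L - l) / fact (L - l))) *
           (\<Sum>n\<le>N. pochhammer (\<kappa> + of_nat l) n / fact n *
                  (pochhammer (\<mu> + of_nat (L - l)) (N - n) / fact (N - n))))"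
    unfolding sum.cartesian_product [symmetric] sum_distrib_left
  proof (intro sum.cong refl)
    fix l n assume "l \<in> {..L}" "n \<in> {..N}"
    then have L: "x ^ L = x ^ l * x ^ (L - l)" and N: "y ^ N = y ^ n * y ^ (N - n)"
      by (simp_all flip: power_add)
    show "konhauser_coeff x y \<kappa> (l, n) * konhauser_coeff x y \<mu> (L - l, N - n) =
        x ^ L * y ^ N *
           (pochhammer (\<kappa> / 2) l / fact l * (pochhammer (\<mu> / 2) (L - l) / fact (L - l))) *
           (pochhammer (\<kappa> + of_nat l) n / fact n *
                  (pochhammer (\<mu> + of_nat (L - l)) (N - n) / fact (N - n)))"
      unfolding konhauser_coeff_def case_prod_conv L N by (simp only: mult_ac)
  qed
  also have "\<dots> = (\<Sum>l\<le>L. x ^ L * y ^ N *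
           (pochhammer (\<kappa> / 2) l / fact l * (pochhammer (\<mu> / 2) (L - l) / fact (L - l))) *
           (pochhammer (\<kappa> + \<mu> + of_nat L) N / fact N))"
  proof (intro sum.cong refl)
    fix l assume "l \<in> {..L}"
    then have "(\<kappa> + of_nat l) + (\<mu> + of_nat (L - l)) = \<kappa> + \<mu> + of_nat L"
      by (simp add: of_nat_diff)
    then show "x ^ L * y ^ N *
           (pochhammer (\<kappa> / 2) l / fact l * (pochhammer (\<mu> / 2) (L - l) / fact (L - l))) *
           (\<Sum>n\<le>N. pochhammer (\<kappa> + of_nat l) n / fact n *
                  (pochhammer (\<mu> + of_nat (L - l)) (N - n) / fact (N - n))) =
        x ^ L * y ^ N *
           (pochhammer (\<kappa> / 2) l / fact l * (pochhammer (\<mu> / 2) (L - l) / fact (L - l))) *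
           (pochhammer (\<kappa> + \<mu> + of_nat L) N / fact N)"
      by (simp only: sum_pochhammer_div_fact)
  qed
  also have "\<dots> = x ^ L * y ^ N * (\<Sum>l\<le>L. 
           pochhammer (\<kappa> / 2) l / fact l * (pochhammer (\<mu> / 2) (L - l) / fact (L - l))) *
           (pochhammer (\<kappa> + \<mu> + of_nat L) N / fact N)"
    by (simp only: sum_distrib_left sum_distrib_right)
  also have "\<dots> = konhauser_coeff x y (\<kappa> + \<mu>) (L, N)"
    by (simp only: sum_pochhammer_div_fact konhauser_coeff_def case_prod_conv add_divide_distrib)
  finally show ?thesis .
qed

lemma konhauser_coeff_0: "konhauser_coeff x y 0 i = (if i = (0, 0) then 1 else 0)"
  by (cases i) (auto simp: konhauser_coeff_def pochhammer_0_left)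

text \<open>
  The modulus is at most the binomial coefficient \<open>(m + n) choose n\<close>.
\<close>

lemma norm_pochhammer_div_fact_le:
  fixes a :: complex
  assumes "norm a \<le> real m"
  shows "norm (pochhammer a n / fact n) \<le> 2 ^ (m + n)"
proof -
  have "norm (pochhammer a n) \<le> pochhammer (real m + 1) n"
  proof (induction n)
    case (Suc n)
    have "norm (a + of_nat n) \<le> real m + 1 + real n"
      using norm_triangle_ineq[of a "of_nat n"] assms by simp
    then have "norm (pochhammer a n) * norm (a + of_nat n) \<le> pochhammer (real m + 1) n * (real m + 1 + real n)"
      by (intro mult_mono Suc) (auto intro!: pochhammer_nonneg)
    then show ?case by (simp add: pochhammer_Suc norm_mult)
  qed auto
  then have "norm (pochhammer a n / fact n) \<le> pochhammer (real m + 1) n / fact n"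
    by (simp add: norm_divide divide_right_mono)
  also have "pochhammer (real m + 1) n / fact n = real ((m + n) choose n)"
  proof -
    have "pochhammer (real m + 1) n = fact (m + n) / fact m"
    proof -
      have "fact (m + n) = (fact m :: real) * pochhammer (real m + 1) n"
        using pochhammer_product'[of "1::real" m n] by (simp add: pochhammer_fact add.commute)
      then show ?thesis by simp
    qed
    then show ?thesis by (simp add: binomial_fact field_simps)
  qed
  also have "\<dots> \<le> 2 ^ (m + n)"
    using binomial_le_pow2[of "m + n" n] by (metis of_nat_le_iff of_nat_numeral of_nat_power)
  finally show ?thesis .
qed

lemma konhauser_coeff_growth:
  "\<exists>A P Q. A \<ge> 0 \<and> P \<ge> 0 \<and> Q \<ge> 0 \<and> (\<forall>l n. norm (konhauser_coeff x y \<kappa> (l, n)) \<le> A * P ^ l * Q ^ n)"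
proof -
  obtain m where m: "norm \<kappa> \<le> real m" using real_arch_simple by blast
  have "norm (konhauser_coeff x y \<kappa> (l, n)) \<le> 4 ^ m * (4 * norm x) ^ l * (2 * norm y) ^ n" for l n
  proof -
    have "norm (\<kappa> / 2) \<le> real m" using m by (simp add: norm_divide)
    then have 1: "norm (pochhammer (\<kappa> / 2) l / fact l) \<le> 2 ^ (m + l)"
      by (rule norm_pochhammer_div_fact_le)
    have "norm (\<kappa> + of_nat l) \<le> real (m + l)"
      using norm_triangle_ineq[of \<kappa> "of_nat l"] m by simp
    then have 2: "norm (pochhammer (\<kappa> + of_nat l) n / fact n) \<le> 2 ^ (m + l + n)"
      by (rule norm_pochhammer_div_fact_le)
    have "norm (konhauser_coeff x y \<kappa> (l, n)) = norm x ^ l * norm y ^ n *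
        (norm (pochhammer (\<kappa> / 2) l / fact l) * norm (pochhammer (\<kappa> + of_nat l) n / fact n))"
      by (simp only: konhauser_coeff_def case_prod_conv norm_mult norm_power mult.assoc)
    also have "\<dots> \<le> norm x ^ l * norm y ^ n * (2 ^ (m + l) * 2 ^ (m + l + n))"
      by (intro mult_left_mono mult_mono 1 2) auto
    also have "\<dots> = 4 ^ m * (4 * norm x) ^ l * (2 * norm y) ^ n"
    proof -
      have "(4::real) = 2 * 2" by simp
      then show ?thesis by (simp only: power_add power_mult_distrib mult_ac)
    qed
    finally show ?thesis .
  qed
  then show ?thesis
    by (intro exI[of _ "4 ^ m"] exI[of _ "4 * norm x"] exI[of _ "2 * norm y"]) auto
qed

definition bi_rl_shift :: "nat \<Rightarrow> complex \<Rightarrow> complex \<Rightarrow> nat \<times> nat \<Rightarrow> real \<times> real \<Rightarrow> complex" where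
  "bi_rl_shift \<upsilon> a b = (\<lambda>(l, n). bi_rl (a + of_nat l) (b + of_nat (\<upsilon> * n)))"

lemma bi_rl_shift_measurable [measurable]: "bi_rl_shift \<upsilon> a b i \<in> borel_measurable borel"
  by (cases i) (simp add: bi_rl_shift_def)

lemma norm_rl_kernel_shift_le:
  assumes "x \<le> X" "X \<ge> 0" "Re a > 0"
  shows "norm (rl_kernel (a + of_nat m) x) \<le> X ^ m / norm (Gamma (a + of_nat m)) * pos_powr (Re a) x"
proof (cases "x > 0")
  case True
  have "pos_powr (Re (a + of_nat m)) x = x ^ m * pos_powr (Re a) x"
    using True powr_add[of x "real m" "Re a - 1"] 
    by (simp add: pos_powr_def powr_realpow add_diff_eq add.commute)
  also have "\<dots> \<le> X ^ m * pos_powr (Re a) x"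
    using assms True by (intro mult_right_mono power_mono) auto
  finally show ?thesis
    by (simp add: norm_rl_kernel divide_right_mono)
qed (simp add: rl_kernel_def pos_powr_def)

text \<open>
  On every region bounded from above, the terms of the series are dominated by a summable
  sequence times the single locally integrable weight \<^term>\<open>bi_pos (Re a) (Re b)\<close>. The
  majorant is a product of two exponential series.
\<close>

lemma bi_rl_shift_dominated:
  assumes ab: "Re a > 0" "Re b > 0" and "\<upsilon> \<ge> 1"
    and c: "\<And>l n. norm (c (l, n)) \<le> A * P ^ l * Q ^ n" and APQ: "A \<ge> 0" "P \<ge> 0" "Q \<ge> 0"
    and "X \<ge> 0" "Y \<ge> 0"
  shows "\<exists>C. C summable_on UNIV \<and> (\<forall>i. C i \<ge> 0) \<and>
    (\<forall>i u. fst u \<le> X \<longrightarrow> snd u \<le> Y \<longrightarrow> norm (c i * bi_rl_shift \<upsilon> a b i u) \<le> C i * bi_pos (Re a) (Re b) u)"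
proof -
  obtain K1 E1 where 1: "K1 \<ge> 0" "E1 \<ge> 1" "\<And>m. 1 / norm (Gamma (a + of_nat m)) \<le> K1 * E1 ^ m / fact m"
    using inverse_Gamma_growth[OF ab(1)] by blast
  obtain K2 E2 where 2: "K2 \<ge> 0" "E2 \<ge> 1" "\<And>m. 1 / norm (Gamma (b + of_nat m)) \<le> K2 * E2 ^ m / fact m"
    using inverse_Gamma_growth[OF ab(2)] by blast
  define f where "f l = A * K1 * ((P * X * E1) ^ l / fact l)" for l :: nat
  define g where "g n = K2 * ((Q * (Y * E2) ^ \<upsilon>) ^ n / fact n)" for n :: nat
  have f0: "f l \<ge> 0" for l
    unfolding f_def using APQ 1(1,2) \<open>X \<ge> 0\<close>
    by (intro mult_nonneg_nonneg divide_nonneg_nonneg zero_le_power) auto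
  have g0: "g n \<ge> 0" for n
    unfolding g_def using APQ 2(1,2) \<open>Y \<ge> 0\<close>
    by (intro mult_nonneg_nonneg divide_nonneg_nonneg zero_le_power) auto
  have exp_series: "summable (\<lambda>n. z ^ n / fact n)" for z :: real
    using summable_exp[of z] by (simp add: field_simps)
  have "summable f" "summable g"
    unfolding f_def g_def by (intro summable_mult exp_series)+
  then have "f summable_on UNIV" "g summable_on UNIV"
    using f0 g0 by (auto simp: summable_on_UNIV_nonneg_real_iff)
  then have sum: "(\<lambda>(l, n). f l * g n) summable_on UNIV \<times> UNIV"
    by (rule summable_on_product_nonneg) (use f0 g0 in auto)
  have "norm (c (l, n) * bi_rl_shift \<upsilon> a b (l, n) u) \<le> (f l * g n) * bi_pos (Re a) (Re b) u"
    if u: "fst u \<le> X" "snd u \<le> Y" for l n u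
  proof -
    have x: "norm (rl_kernel (a + of_nat l) (fst u)) \<le> (X ^ l * (K1 * E1 ^ l / fact l)) * pos_powr (Re a) (fst u)"
    proof -
      have "norm (rl_kernel (a + of_nat l) (fst u)) \<le> X ^ l * (1 / norm (Gamma (a + of_nat l))) * pos_powr (Re a) (fst u)"
        using norm_rl_kernel_shift_le[OF u(1) \<open>X \<ge> 0\<close> ab(1), of l] by simp
      also have "\<dots> \<le> X ^ l * (K1 * E1 ^ l / fact l) * pos_powr (Re a) (fst u)"
        using \<open>X \<ge> 0\<close> by (intro mult_right_mono mult_left_mono 1) auto
      finally show ?thesis .
    qed
    have y: "norm (rl_kernel (b + of_nat (\<upsilon> * n)) (snd u)) \<le> ((Y ^ \<upsilon>) ^ n * (K2 * (E2 ^ \<upsilon>) ^ n / fact n)) * pos_powr (Re b) (snd u)"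
    proof -
      have "norm (rl_kernel (b + of_nat (\<upsilon> * n)) (snd u)) \<le> Y ^ (\<upsilon> * n) * (1 / norm (Gamma (b + of_nat (\<upsilon> * n)))) * pos_powr (Re b) (snd u)"
        using norm_rl_kernel_shift_le[OF u(2) \<open>Y \<ge> 0\<close> ab(2), of "\<upsilon> * n"] by simp
      also have "\<dots> \<le> Y ^ (\<upsilon> * n) * (K2 * E2 ^ (\<upsilon> * n) / fact (\<upsilon> * n)) * pos_powr (Re b) (snd u)"
        using \<open>Y \<ge> 0\<close> by (intro mult_right_mono mult_left_mono 2) auto
      also have "\<dots> \<le> Y ^ (\<upsilon> * n) * (K2 * E2 ^ (\<upsilon> * n) / fact n) * pos_powr (Re b) (snd u)"
        using \<open>Y \<ge> 0\<close> 2(1,2) \<open>\<upsilon> \<ge> 1\<close> by (intro mult_right_mono mult_left_mono divide_left_mono fact_mono) auto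
      finally show ?thesis by (simp add: power_mult)
    qed
    have "norm (c (l, n) * bi_rl_shift \<upsilon> a b (l, n) u) = norm (c (l, n)) *
         (norm (rl_kernel (a + of_nat l) (fst u)) * norm (rl_kernel (b + of_nat (\<upsilon> * n)) (snd u)))"
      by (simp add: bi_rl_shift_def bi_rl_def norm_mult)
    also have "\<dots> \<le> (A * P ^ l * Q ^ n) * 
         (((X ^ l * (K1 * E1 ^ l / fact l)) * pos_powr (Re a) (fst u)) *
          (((Y ^ \<upsilon>) ^ n * (K2 * (E2 ^ \<upsilon>) ^ n / fact n)) * pos_powr (Re b) (snd u)))"
      using APQ 1(1,2) 2(1,2) \<open>X \<ge> 0\<close> \<open>Y \<ge> 0\<close>
      by (intro mult_mono c x y mult_nonneg_nonneg) auto
    also have "\<dots> = (f l * g n) * bi_pos (Re a) (Re b) u"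
      by (simp add: f_def g_def bi_pos_def power_mult_distrib)
    finally show ?thesis .
  qed
  with sum f0 g0 show ?thesis
    by (intro exI[of _ "\<lambda>(l, n). f l * g n"]) auto
qed

text \<open>
  On the open quadrant this is \<open>r powr (a - 1) * s powr (b - 1)\<close> times a double power series in
  \<open>r\<close> and \<open>s ^ \<upsilon>\<close>, where \<open>(r, s)\<close> is the argument \<open>u\<close>. Absorbing the two powers into the terms makes
  each term a product of Riemann--Liouville kernels.
\<close>

definition konhauser_kernel ::
    "nat \<Rightarrow> complex \<Rightarrow> complex \<Rightarrow> complex \<Rightarrow> complex \<Rightarrow> complex \<Rightarrow> real \<times> real \<Rightarrow> complex" where
  "konhauser_kernel \<upsilon> x y \<kappa> a b u = (\<Sum>\<^sub>\<infinity>i. konhauser_coeff x y \<kappa> i * bi_rl_shift \<upsilon> a b i u)"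

lemma konhauser_term_dominated:
  assumes "Re a > 0" "Re b > 0" and "\<upsilon> \<ge> 1" and "X \<ge> 0" "Y \<ge> 0"
  obtains C where "C summable_on UNIV" "\<And>i. C i \<ge> 0"
    "\<And>i u. fst u \<le> X \<Longrightarrow> snd u \<le> Y \<Longrightarrow>
       norm (konhauser_coeff x y \<kappa> i * bi_rl_shift \<upsilon> a b i u) \<le> C i * bi_pos (Re a) (Re b) u"
proof -
  obtain A P Q where "A \<ge> 0" "P \<ge> 0" "Q \<ge> 0"
    "\<And>l n. norm (konhauser_coeff x y \<kappa> (l, n)) \<le> A * P ^ l * Q ^ n"
    using konhauser_coeff_growth by blast
  then show ?thesis
    using bi_rl_shift_dominated[of a b \<upsilon> "konhauser_coeff x y \<kappa>" A P Q X Y] assms that by blast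
qed

lemma konhauser_abs_summable:
  assumes "Re a > 0" "Re b > 0" and "\<upsilon> \<ge> 1"
  shows "(\<lambda>i. norm (konhauser_coeff x y \<kappa> i * bi_rl_shift \<upsilon> a b i u)) summable_on UNIV"
proof -
  obtain C where C: "C summable_on UNIV" "\<And>i. C i \<ge> 0"
    "\<And>i v. fst v \<le> max 0 (fst u) \<Longrightarrow> snd v \<le> max 0 (snd u) \<Longrightarrow>
       norm (konhauser_coeff x y \<kappa> i * bi_rl_shift \<upsilon> a b i v) \<le> C i * bi_pos (Re a) (Re b) v"
    using konhauser_term_dominated[OF assms max.cobounded1 max.cobounded1] by metis
  show ?thesis
    by (rule summable_on_comparison_test[OF summable_on_cmult_left[OF C(1), of "bi_pos (Re a) (Re b) u"]])
       (use C(3)[of u] in auto)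
qed

lemma konhauser_has_sum:
  assumes "Re a > 0" "Re b > 0" and "\<upsilon> \<ge> 1"
  shows "((\<lambda>i. konhauser_coeff x y \<kappa> i * bi_rl_shift \<upsilon> a b i u) has_sum konhauser_kernel \<upsilon> x y \<kappa> a b u) UNIV"
  unfolding konhauser_kernel_def
  by (rule has_sum_infsum[OF abs_summable_summable[OF konhauser_abs_summable[OF assms]]])

lemma konhauser_kernel_bound:
  assumes "Re a > 0" "Re b > 0" and "\<upsilon> \<ge> 1" and "X \<ge> 0" "Y \<ge> 0"
  obtains M where "M \<ge> 0" "\<And>u. fst u \<le> X \<Longrightarrow> snd u \<le> Y \<Longrightarrow>
       norm (konhauser_kernel \<upsilon> x y \<kappa> a b u) \<le> M * bi_pos (Re a) (Re b) u"
proof -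
  obtain C where C: "C summable_on UNIV" "\<And>i. C i \<ge> 0"
    "\<And>i u. fst u \<le> X \<Longrightarrow> snd u \<le> Y \<Longrightarrow>
       norm (konhauser_coeff x y \<kappa> i * bi_rl_shift \<upsilon> a b i u) \<le> C i * bi_pos (Re a) (Re b) u"
    using konhauser_term_dominated[OF assms] by metis
  have "norm (konhauser_kernel \<upsilon> x y \<kappa> a b u) \<le> infsum C UNIV * bi_pos (Re a) (Re b) u"
    if u: "fst u \<le> X" "snd u \<le> Y" for u
  proof -
    have "norm (konhauser_kernel \<upsilon> x y \<kappa> a b u) \<le> (\<Sum>\<^sub>\<infinity>i. norm (konhauser_coeff x y \<kappa> i * bi_rl_shift \<upsilon> a b i u))"
      unfolding konhauser_kernel_def by (rule norm_infsum_bound[OF konhauser_abs_summable]) (use assms in auto)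
    also have "\<dots> \<le> (\<Sum>\<^sub>\<infinity>i. C i * bi_pos (Re a) (Re b) u)"
      by (rule infsum_mono[OF konhauser_abs_summable summable_on_cmult_left[OF C(1)]]) 
         (use C(3) u assms in auto)
    also have "\<dots> = infsum C UNIV * bi_pos (Re a) (Re b) u"
      by (rule infsum_cmult_left) (use C in auto)
    finally show ?thesis .
  qed
  then show ?thesis using that[of "infsum C UNIV"] C(2) by (simp add: infsum_nonneg)
qed

lemma konhauser_kernel_measurable:
  assumes "Re a > 0" "Re b > 0" and "\<upsilon> \<ge> 1"
  shows "konhauser_kernel \<upsilon> x y \<kappa> a b \<in> borel_measurable borel"
proof -
  have "konhauser_kernel \<upsilon> x y \<kappa> a b u =
      (\<Sum>m. konhauser_coeff x y \<kappa> (prod_decode m) * bi_rl_shift \<upsilon> a b (prod_decode m) u)" for u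
    using konhauser_has_sum[OF assms, of x y \<kappa> u]
      has_sum_reindex_bij_betw[OF bij_prod_decode, of "\<lambda>i. konhauser_coeff x y \<kappa> i * bi_rl_shift \<upsilon> a b i u"]
    by (metis (no_types, lifting) has_sum_imp_sums sums_unique)
  then have "konhauser_kernel \<upsilon> x y \<kappa> a b = (\<lambda>u.
      \<Sum>m. konhauser_coeff x y \<kappa> (prod_decode m) * bi_rl_shift \<upsilon> a b (prod_decode m) u)"
    by (rule ext)
  also have "\<dots> \<in> borel_measurable borel"
    by (rule borel_measurable_suminf) measurable
  finally show ?thesis .
qed

text \<open>
  For \<open>\<kappa> = 0\<close> the generating function is 1 and only the leading term survives.
\<close>

lemma konhauser_kernel_0:
  "konhauser_kernel \<upsilon> x y 0 a b u = bi_rl a b u"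
proof -
  have "konhauser_kernel \<upsilon> x y 0 a b u = (\<Sum>\<^sub>\<infinity>i\<in>{(0, 0)}. bi_rl_shift \<upsilon> a b i u)"
    unfolding konhauser_kernel_def
    by (rule infsum_cong_neutral) (auto simp: konhauser_coeff_0)
  then show ?thesis by (simp add: bi_rl_shift_def)
qed

lemma bi_rl_shift_convolution:
  assumes "Re a > 0" "Re b > 0" "Re a' > 0" "Re b' > 0"
  shows "(\<integral>v. bi_rl_shift \<upsilon> a b (l, n) (u - v) * bi_rl_shift \<upsilon> a' b' (l', n') v \<partial>lborel)
       = bi_rl_shift \<upsilon> (a + a') (b + b') (l + l', n + n') u"
proof -
  have "a + of_nat l + (a' + of_nat l') = a + a' + of_nat (l + l')"
    "b + of_nat (\<upsilon> * n) + (b' + of_nat (\<upsilon> * n')) = b + b' + of_nat (\<upsilon> * (n + n'))"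
    by (simp_all add: algebra_simps)
  moreover have "Re (a + of_nat l) > 0" "Re (b + of_nat (\<upsilon> * n)) > 0"
    "Re (a' + of_nat l') > 0" "Re (b' + of_nat (\<upsilon> * n')) > 0"
    using assms by (auto intro: add_pos_nonneg)
  ultimately show ?thesis
    using bi_rl_convolution[of "a + of_nat l" "b + of_nat (\<upsilon> * n)" "a' + of_nat l'" "b' + of_nat (\<upsilon> * n')" u]
    by (simp only: bi_rl_shift_def case_prod_conv)
qed

text \<open>
  Both series are multiplied out and integrated termwise; the convolution of two terms is the
  term whose index is the sum of the two indices, and collecting equal index sums leaves the
  Cauchy product of the coefficients. Hence all three parameters add.
\<close>

theorem konhauser_kernel_convolution:
  assumes ab: "Re a > 0" "Re b > 0" and ab': "Re a' > 0" "Re b' > 0" and \<upsilon>: "\<upsilon> \<ge> 1"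
  shows "(\<integral>v. konhauser_kernel \<upsilon> x y \<kappa> a b (u - v) * konhauser_kernel \<upsilon> x y \<mu> a' b' v \<partial>lborel)
       = konhauser_kernel \<upsilon> x y (\<kappa> + \<mu>) (a + a') (b + b') u"
proof -
  define X Y where "X = max 0 (fst u)" and "Y = max 0 (snd u)"
  have XY: "X \<ge> 0" "Y \<ge> 0" "fst u \<le> X" "snd u \<le> Y" by (auto simp: X_def Y_def)
  define s where "s = (\<lambda>i v. konhauser_coeff x y \<kappa> i * bi_rl_shift \<upsilon> a b i v)"
  define t where "t = (\<lambda>i v. konhauser_coeff x y \<mu> i * bi_rl_shift \<upsilon> a' b' i v)"
  have [measurable]: "s i \<in> borel_measurable borel" "t i \<in> borel_measurable borel" for i
    unfolding s_def t_def by measurable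
  obtain C where C: "C summable_on UNIV" "\<And>i. C i \<ge> 0"
    "\<And>i v. fst v \<le> X \<Longrightarrow> snd v \<le> Y \<Longrightarrow> norm (s i v) \<le> C i * bi_pos (Re a) (Re b) v"
    using konhauser_term_dominated[OF ab \<upsilon> XY(1,2)] unfolding s_def by metis
  obtain D where D: "D summable_on UNIV" "\<And>i. D i \<ge> 0"
    "\<And>i v. fst v \<le> X \<Longrightarrow> snd v \<le> Y \<Longrightarrow> norm (t i v) \<le> D i * bi_pos (Re a') (Re b') v"
    using konhauser_term_dominated[OF ab' \<upsilon> XY(1,2)] unfolding t_def by metis
  \<comment> \<open>the weight that dominates all products of terms; its integral is a product of Beta integrals\<close>
  define w where "w v = bi_pos (Re a) (Re b) (u - v) * bi_pos (Re a') (Re b') v" for v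
  define f where "f = (\<lambda>(i, j) v. s i (u - v) * t j v)"
  define CD where "CD = (\<lambda>(i, j). C i * D j)"
  have CD: "CD summable_on UNIV" "\<And>ij. CD ij \<ge> 0"
    using summable_on_product_nonneg[OF C(1) D(1)] C(2) D(2) by (auto simp: CD_def)
  have bound: "norm (f ij v) \<le> CD ij * w v" for ij v
  proof -
    obtain i j where Pair: "ij = (i, j)" by (cases ij)
    show ?thesis
    proof (cases "0 < fst v \<and> 0 < snd v \<and> fst v < fst u \<and> snd v < snd u")
      case True
      then have "norm (s i (u - v)) \<le> C i * bi_pos (Re a) (Re b) (u - v)"
        "norm (t j v) \<le> D j * bi_pos (Re a') (Re b') v"
        using XY by (intro C D; simp)+
      then have "norm (s i (u - v)) * norm (t j v) \<le>
          (C i * bi_pos (Re a) (Re b) (u - v)) * (D j * bi_pos (Re a') (Re b') v)"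
        by (intro mult_mono) (auto intro!: mult_nonneg_nonneg C D)
      then show ?thesis
        by (simp add: Pair f_def CD_def w_def norm_mult mult_ac)
    next
      case False
      then have "s i (u - v) * t j v = 0"
        by (cases i; cases j) (auto simp: s_def t_def bi_rl_shift_def bi_rl_def rl_kernel_def)
      then have "f ij v = 0" by (simp only: Pair f_def case_prod_conv)
      with CD(2)[of ij] show ?thesis by (simp add: w_def)
    qed
  qed
  have w: "integrable lborel w" "\<And>v. w v \<ge> 0"
    using ab ab' integrable_bi_pos_product unfolding w_def by auto
  have meas: "f ij \<in> borel_measurable lborel" for ij
    unfolding f_def by (cases ij) auto
  have sum: "((\<lambda>ij. integral\<^sup>L lborel (f ij)) has_sum (\<integral>v. (\<Sum>\<^sub>\<infinity>ij. f ij v) \<partial>lborel)) UNIV"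
    by (rule has_sum_integral_dominated[OF meas bound w(1) CD(1) w(2) CD(2)])
  have integrand: "(\<Sum>\<^sub>\<infinity>ij. f ij v) =
      konhauser_kernel \<upsilon> x y \<kappa> a b (u - v) * konhauser_kernel \<upsilon> x y \<mu> a' b' v" for v
  proof -
    have "(\<lambda>ij. norm (f ij v)) summable_on UNIV"
      by (rule summable_on_comparison_test[OF summable_on_cmult_left[OF CD(1), of "w v"]])
         (use bound in auto)
    then have "((\<lambda>ij. f ij v) has_sum (\<Sum>\<^sub>\<infinity>ij. f ij v)) (UNIV \<times> UNIV)"
      using has_sum_infsum[OF abs_summable_summable] by fastforce
    moreover have "((\<lambda>j. f (i, j) v) has_sum s i (u - v) * konhauser_kernel \<upsilon> x y \<mu> a' b' v) UNIV" for i
      using has_sum_cmult_right[OF konhauser_has_sum[OF ab' \<upsilon>, of x y \<mu> v]]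
      by (simp add: f_def t_def)
    ultimately have "((\<lambda>i. s i (u - v) * konhauser_kernel \<upsilon> x y \<mu> a' b' v) has_sum (\<Sum>\<^sub>\<infinity>ij. f ij v)) UNIV"
      by (rule has_sum_SigmaD)
    moreover have "((\<lambda>i. s i (u - v) * konhauser_kernel \<upsilon> x y \<mu> a' b' v) has_sum
       konhauser_kernel \<upsilon> x y \<kappa> a b (u - v) * konhauser_kernel \<upsilon> x y \<mu> a' b' v) UNIV"
      unfolding s_def by (rule has_sum_cmult_left[OF konhauser_has_sum[OF ab \<upsilon>]])
    ultimately show ?thesis by (rule has_sum_unique)
  qed
  \<comment> \<open>the summands reindexed by the index sum \<open>(L, N)\<close> and the first index \<open>(l, n)\<close>\<close>
  define g where "g = (\<lambda>((L, N), (l, n)). konhauser_coeff x y \<kappa> (l, n) * konhauser_coeff x y \<mu> (L - l, N - n) *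
      bi_rl_shift \<upsilon> (a + a') (b + b') (L, N) u)"
  have int: "integral\<^sup>L lborel (f ((l, n), (l', n'))) = konhauser_coeff x y \<kappa> (l, n) * konhauser_coeff x y \<mu> (l', n') *
      bi_rl_shift \<upsilon> (a + a') (b + b') (l + l', n + n') u" for l n l' n'
  proof -
    have "integral\<^sup>L lborel (f ((l, n), (l', n'))) =
       (\<integral>v. (konhauser_coeff x y \<kappa> (l, n) * konhauser_coeff x y \<mu> (l', n')) *
         (bi_rl_shift \<upsilon> a b (l, n) (u - v) * bi_rl_shift \<upsilon> a' b' (l', n') v) \<partial>lborel)"
      by (intro Bochner_Integration.integral_cong) (simp_all add: f_def s_def t_def mult_ac)
    then show ?thesis by (simp add: bi_rl_shift_convolution[OF ab ab'])
  qed
  have "(g has_sum (\<integral>v. (\<Sum>\<^sub>\<infinity>ij. f ij v) \<partial>lborel)) (Sigma UNIV (\<lambda>(L, N). {..L} \<times> {..N}))"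
    using sum
    by (subst has_sum_reindex_bij_witness[of _ "\<lambda>((l, n), (l', n')). ((l + l', n + n'), (l, n))"
          "\<lambda>((L, N), (l, n)). ((l, n), (L - l, N - n))" UNIV "\<lambda>ij. integral\<^sup>L lborel (f ij)"])
       (auto simp: g_def int)
  moreover have "((\<lambda>i. g (LN, i)) has_sum
      konhauser_coeff x y (\<kappa> + \<mu>) LN * bi_rl_shift \<upsilon> (a + a') (b + b') LN u) (case LN of (L, N) \<Rightarrow> {..L} \<times> {..N})" for LN
  proof -
    obtain L N where Pair: "LN = (L, N)" by (cases LN)
    have "(\<Sum>i\<in>{..L} \<times> {..N}. g (LN, i)) =
       konhauser_coeff x y (\<kappa> + \<mu>) LN * bi_rl_shift \<upsilon> (a + a') (b + b') LN u"
      unfolding Pair konhauser_coeff_convolution[symmetric] sum_distrib_right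
      by (intro sum.cong) (auto simp: g_def)
    then show ?thesis unfolding Pair case_prod_conv
      using has_sum_finite[of "{..L} \<times> {..N}" "\<lambda>i. g ((L, N), i)"] by simp
  qed
  ultimately have "((\<lambda>LN. konhauser_coeff x y (\<kappa> + \<mu>) LN * bi_rl_shift \<upsilon> (a + a') (b + b') LN u)
      has_sum (\<integral>v. (\<Sum>\<^sub>\<infinity>ij. f ij v) \<partial>lborel)) UNIV"
    by (rule has_sum_SigmaD)
  then show ?thesis
    unfolding integrand konhauser_kernel_def by (simp add: infsumI)
qed

section \<open>Convolution and Lebesgue integrals over the quadrant\<close>

text \<open>
  Associativity of convolution at a single point \<open>u\<close>, by Fubini. The finiteness of the iterated
  integral of the norms at this one point yields, besides the identity, the convergence of the
  inner convolution at almost every \<open>v\<close> with \<open>k (u - v) \<noteq> 0\<close>.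
\<close>

lemma convolution_assoc:
  fixes k h G :: "'a::euclidean_space \<Rightarrow> complex"
  assumes [measurable]: "k \<in> borel_measurable borel" "h \<in> borel_measurable borel" "G \<in> borel_measurable borel"
    and fin: "(\<integral>\<^sup>+w. (\<integral>\<^sup>+v. ennreal (norm (k (u - v)) * norm (h (v - w))) \<partial>lborel) * ennreal (norm (G w)) \<partial>lborel) < \<infinity>"
  shows "AE v in lborel. integrable lborel (\<lambda>w. k (u - v) * (h (v - w) * G w))"
    and "integrable lborel (\<lambda>v. k (u - v) * (\<integral>w. h (v - w) * G w \<partial>lborel))"
    and "(\<integral>v. k (u - v) * (\<integral>w. h (v - w) * G w \<partial>lborel) \<partial>lborel)
       = (\<integral>w. (\<integral>v. k (u - w - v) * h v \<partial>lborel) * G w \<partial>lborel)"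
proof -
  define F where "F v w = k (u - v) * (h (v - w) * G w)" for v w
  have int: "integrable (lborel \<Otimes>\<^sub>M lborel) (case_prod F)"
  proof (rule integrableI_bounded)
    show [measurable]: "case_prod F \<in> borel_measurable (lborel \<Otimes>\<^sub>M lborel)"
      unfolding F_def by measurable
    have "(\<integral>\<^sup>+vw. ennreal (norm (case_prod F vw)) \<partial>(lborel \<Otimes>\<^sub>M lborel))
        = (\<integral>\<^sup>+w. \<integral>\<^sup>+v. ennreal (norm (F v w)) \<partial>lborel \<partial>lborel)"
      by (subst lborel_pair.nn_integral_snd[symmetric]) (auto simp: case_prod_unfold)
    also have "\<dots> = (\<integral>\<^sup>+w. (\<integral>\<^sup>+v. ennreal (norm (k (u - v)) * norm (h (v - w))) \<partial>lborel) * ennreal (norm (G w)) \<partial>lborel)"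
      by (subst nn_integral_multc[symmetric]) 
         (auto intro!: nn_integral_cong simp: F_def norm_mult mult.assoc simp flip: ennreal_mult)
    finally show "(\<integral>\<^sup>+vw. ennreal (norm (case_prod F vw)) \<partial>(lborel \<Otimes>\<^sub>M lborel)) < \<infinity>"
      using fin by simp
  qed
  show "AE v in lborel. integrable lborel (\<lambda>w. k (u - v) * (h (v - w) * G w))"
    using lborel_pair.AE_integrable_fst[OF int] by (simp add: F_def)
  show "integrable lborel (\<lambda>v. k (u - v) * (\<integral>w. h (v - w) * G w \<partial>lborel))"
    using lborel_pair.integrable_fst[OF int] by (simp add: F_def)
  have "(\<integral>v. k (u - v) * (\<integral>w. h (v - w) * G w \<partial>lborel) \<partial>lborel) = (\<integral>v. \<integral>w. F v w \<partial>lborel \<partial>lborel)"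
    by (simp add: F_def)
  also have "\<dots> = (\<integral>w. \<integral>v. F v w \<partial>lborel \<partial>lborel)"
    by (rule lborel_pair.Fubini_integral[OF int, symmetric])
  also have "\<dots> = (\<integral>w. (\<integral>v. k (u - w - v) * h v \<partial>lborel) * G w \<partial>lborel)"
  proof (rule Bochner_Integration.integral_cong[OF refl])
    fix w
    have "F v w = (k (u - w - (v - w)) * h (v - w)) * G w" for v
      by (simp add: F_def)
    then show "(\<integral>v. F v w \<partial>lborel) = (\<integral>v. k (u - w - v) * h v \<partial>lborel) * G w"
      using integral_lborel_translate[of "\<lambda>v. k (u - w - v) * h v" w] by simp
  qed
  finally show "(\<integral>v. k (u - v) * (\<integral>w. h (v - w) * G w \<partial>lborel) \<partial>lborel)
       = (\<integral>w. (\<integral>v. k (u - w - v) * h v \<partial>lborel) * G w \<partial>lborel)" .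
qed

lemma lebesgue_borel_representative:
  fixes f :: "'a::euclidean_space \<Rightarrow> complex"
  assumes [measurable]: "f \<in> borel_measurable lebesgue"
  obtains f' where "f' \<in> borel_measurable borel" "AE x in lborel. f x = f' x"
proof -
  have "(\<lambda>x. Re (f x)) \<in> borel_measurable lebesgue" "(\<lambda>x. Im (f x)) \<in> borel_measurable lebesgue"
    by measurable
  from this[THEN completion_ex_borel_measurable_real]
  obtain r i where [measurable]: "r \<in> borel_measurable lborel" "i \<in> borel_measurable lborel"
    and ae: "AE x in lborel. Re (f x) = r x" "AE x in lborel. Im (f x) = i x" by blast
  from ae have "AE x in lborel. f x = Complex (r x) (i x)"
    by eventually_elim (simp add: complex_eq_iff)
  moreover have "(\<lambda>x. Complex (r x) (i x)) \<in> borel_measurable borel"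
    unfolding Complex_eq by measurable
  ultimately show ?thesis using that by blast
qed

text \<open>
  Integrals with respect to the completed measure are computed from a Borel measurable function
  that agrees almost everywhere; this reduces all statements to \<^term>\<open>lborel\<close>.
\<close>

lemma lebesgue_AE_borel:
  fixes f f' :: "'a::euclidean_space \<Rightarrow> complex"
  assumes f' [measurable]: "f' \<in> borel_measurable borel" and ae: "AE x in lborel. f x = f' x"
  shows "f \<in> borel_measurable lebesgue"
    and "integrable lebesgue f \<longleftrightarrow> integrable lborel f'"
    and "integral\<^sup>L lebesgue f = integral\<^sup>L lborel f'"
proof -
  have ae': "AE x in lebesgue. f' x = f x" using ae by (auto simp: AE_completion_iff)
  have m': "f' \<in> borel_measurable lebesgue" by (rule measurable_completion) simp
  show m: "f \<in> borel_measurable lebesgue"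
    by (rule borel_measurable_AE[OF m' ae'])
  show "integrable lebesgue f \<longleftrightarrow> integrable lborel f'"
    using integrable_cong_AE[OF m' m ae'] integrable_completion[of f' lborel] by simp
  show "integral\<^sup>L lebesgue f = integral\<^sup>L lborel f'"
    using integral_cong_AE[OF m' m ae'] integral_completion[of f' lborel] by simp
qed

text \<open>
  Lebesgue measure on the plane is not the product of the completed measures on the lines.
  A Borel representative \<open>f'\<close> satisfies Fubini's theorem, and almost all sections of \<open>f\<close> agree
  almost everywhere with those of \<open>f'\<close>.
\<close>

lemma lebesgue_Fubini:
  fixes f :: "real \<times> real \<Rightarrow> complex"
  assumes f' [measurable]: "f' \<in> borel_measurable borel" and ae: "AE u in lborel. f u = f' u"
    and int: "integrable lborel f'"
  shows "(\<integral>x. (\<integral>y. f (x, y) \<partial>lebesgue) \<partial>lebesgue) = integral\<^sup>L lborel f'"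
    and "(\<integral>y. (\<integral>x. f (x, y) \<partial>lebesgue) \<partial>lebesgue) = integral\<^sup>L lborel f'"
proof -
  have [measurable]: "f' \<in> borel_measurable (lborel \<Otimes>\<^sub>M lborel)" by (simp add: lborel_prod)
  have int': "integrable (lborel \<Otimes>\<^sub>M lborel) (case_prod (\<lambda>x y. f' (x, y)))"
    using int by (simp add: lborel_prod)
  have ae': "AE u in lborel \<Otimes>\<^sub>M lborel. f u = f' u" unfolding lborel_prod by (rule ae)
  have "AE x in lborel. AE y in lborel. f (x, y) = f' (x, y)"
    using lborel_pair.AE_pair[OF ae'] by simp
  then have "AE x in lborel. (\<integral>y. f (x, y) \<partial>lebesgue) = (\<integral>y. f' (x, y) \<partial>lborel)"
    by eventually_elim (rule lebesgue_AE_borel, auto)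
  then have "(\<integral>x. (\<integral>y. f (x, y) \<partial>lebesgue) \<partial>lebesgue) = (\<integral>x. (\<integral>y. f' (x, y) \<partial>lborel) \<partial>lborel)"
    by (rule lebesgue_AE_borel(3)[rotated]) measurable
  also have "\<dots> = integral\<^sup>L lborel f'"
    using lborel_pair.integral_fst[OF int'] by (simp add: lborel_prod)
  finally show "(\<integral>x. (\<integral>y. f (x, y) \<partial>lebesgue) \<partial>lebesgue) = integral\<^sup>L lborel f'" .
  have "AE y in lborel. AE x in lborel. f (x, y) = f' (x, y)"
  proof -
    obtain N where N: "N \<in> null_sets (lborel \<Otimes>\<^sub>M lborel)" "\<And>u. u \<notin> N \<Longrightarrow> f u = f' u"
      using AE_E3[OF ae'] by (metis DiffI UNIV_I UNIV_Times_UNIV space_borel space_lborel space_pair_measure)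
    have [measurable]: "N \<in> sets (lborel \<Otimes>\<^sub>M lborel)" using N(1) by auto
    have "AE x in lborel. AE y in lborel. (x, y) \<notin> N"
      using lborel_pair.AE_pair[OF AE_not_in[OF N(1)]] by simp
    then have "AE y in lborel. AE x in lborel. (x, y) \<notin> N"
    proof (subst (asm) lborel_pair.AE_commute)
      have "{u \<in> space (lborel \<Otimes>\<^sub>M lborel). (fst u, snd u) \<notin> N} = space (lborel \<Otimes>\<^sub>M lborel) - N"
        by auto
      then show "{u \<in> space (lborel \<Otimes>\<^sub>M lborel). (fst u, snd u) \<notin> N} \<in> sets (lborel \<Otimes>\<^sub>M lborel)"
        by (simp only: sets.compl_sets \<open>N \<in> sets (lborel \<Otimes>\<^sub>M lborel)\<close>)
    qed
    then show ?thesis using N(2) by (auto elim!: eventually_mono)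
  qed
  then have "AE y in lborel. (\<integral>x. f (x, y) \<partial>lebesgue) = (\<integral>x. f' (x, y) \<partial>lborel)"
    by eventually_elim (rule lebesgue_AE_borel, auto)
  then have "(\<integral>y. (\<integral>x. f (x, y) \<partial>lebesgue) \<partial>lebesgue) = (\<integral>y. (\<integral>x. f' (x, y) \<partial>lborel) \<partial>lborel)"
    by (rule lebesgue_AE_borel(3)[rotated]) measurable
  also have "\<dots> = integral\<^sup>L lborel f'"
    using lborel_pair.integral_snd[OF int'] by (simp add: lborel_prod)
  finally show "(\<integral>y. (\<integral>x. f (x, y) \<partial>lebesgue) \<partial>lebesgue) = integral\<^sup>L lborel f'" .
qed

abbreviation quadrant :: "(real \<times> real) set" where
  "quadrant \<equiv> {0<..} \<times> {0<..}"

text \<open>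
  Translates the iterated integrals over bounded rectangles into convolutions over the plane
  of functions supported in the open quadrant: \<open>h (u - v) * \<Phi> v\<close> is nonzero only if \<open>v\<close> lies
  strictly between the origin and \<open>u\<close> in both coordinates.
\<close>

lemma quadrant_convolution:
  fixes f \<phi> :: "real \<Rightarrow> real \<Rightarrow> complex" and h \<Phi> :: "real \<times> real \<Rightarrow> complex"
  assumes [measurable]: "h \<in> borel_measurable borel" "\<Phi> \<in> borel_measurable borel"
    and h0: "\<And>v. v \<notin> quadrant \<Longrightarrow> h v = 0" and \<Phi>0: "\<And>v. v \<notin> quadrant \<Longrightarrow> \<Phi> v = 0"
    and ae: "AE v in lborel. v \<in> quadrant \<longrightarrow> \<phi> (fst v) (snd v) = \<Phi> v"
    and f: "\<And>\<xi> y. 0 < \<xi> \<Longrightarrow> \<xi> < z \<Longrightarrow> 0 < y \<Longrightarrow> y < t \<Longrightarrow> f \<xi> y = h (z - \<xi>, t - y) * \<phi> \<xi> y"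
  shows "(\<lambda>(\<xi>, y). f \<xi> y) absolutely_integrable_on {0<..<z} \<times> {0<..<t} \<longleftrightarrow>
         integrable lborel (\<lambda>v. h ((z, t) - v) * \<Phi> v)"
    and "integrable lborel (\<lambda>v. h ((z, t) - v) * \<Phi> v) \<Longrightarrow>
      (LINT \<xi>:{0<..<z}|lebesgue. LINT y:{0<..<t}|lebesgue. f \<xi> y) = (\<integral>v. h ((z, t) - v) * \<Phi> v \<partial>lborel)"
    and "integrable lborel (\<lambda>v. h ((z, t) - v) * \<Phi> v) \<Longrightarrow>
      (LINT y:{0<..<t}|lebesgue. LINT \<xi>:{0<..<z}|lebesgue. f \<xi> y) = (\<integral>v. h ((z, t) - v) * \<Phi> v \<partial>lborel)"
proof -
  define F where "F v = indicator ({0<..<z} \<times> {0<..<t}) v *\<^sub>R f (fst v) (snd v)" for v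
  have meas: "(\<lambda>v. h ((z, t) - v) * \<Phi> v) \<in> borel_measurable borel" by measurable
  have eq: "AE v in lborel. F v = h ((z, t) - v) * \<Phi> v"
    using ae
  proof eventually_elim
    fix v assume v: "v \<in> quadrant \<longrightarrow> \<phi> (fst v) (snd v) = \<Phi> v"
    show "F v = h ((z, t) - v) * \<Phi> v"
    proof (cases "v \<in> {0<..<z} \<times> {0<..<t}")
      case True
      then show ?thesis using v f[of "fst v" "snd v"] by (cases v) (auto simp: F_def)
    next
      case False
      then have "(z, t) - v \<notin> quadrant \<or> v \<notin> quadrant" by (cases v) auto
      then have "h ((z, t) - v) * \<Phi> v = 0" using h0 \<Phi>0 by (metis mult_eq_0_iff)
      then show ?thesis using False by (simp add: F_def)
    qed
  qed
  have "(\<lambda>(\<xi>, y). f \<xi> y) absolutely_integrable_on {0<..<z} \<times> {0<..<t} \<longleftrightarrow> integrable lebesgue F"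
    by (simp add: set_integrable_def F_def[abs_def] case_prod_unfold)
  then show "(\<lambda>(\<xi>, y). f \<xi> y) absolutely_integrable_on {0<..<z} \<times> {0<..<t} \<longleftrightarrow>
         integrable lborel (\<lambda>v. h ((z, t) - v) * \<Phi> v)"
    using lebesgue_AE_borel(2)[OF meas eq] by simp
  assume int: "integrable lborel (\<lambda>v. h ((z, t) - v) * \<Phi> v)"
  have "(LINT \<xi>:{0<..<z}|lebesgue. LINT y:{0<..<t}|lebesgue. f \<xi> y) = (\<integral>\<xi>. \<integral>y. F (\<xi>, y) \<partial>lebesgue \<partial>lebesgue)"
    by (simp add: set_lebesgue_integral_def F_def indicator_times flip: integral_scaleR_right)
  then show "(LINT \<xi>:{0<..<z}|lebesgue. LINT y:{0<..<t}|lebesgue. f \<xi> y) = (\<integral>v. h ((z, t) - v) * \<Phi> v \<partial>lborel)"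
    using lebesgue_Fubini(1)[OF meas eq int] by simp
  have "(LINT y:{0<..<t}|lebesgue. LINT \<xi>:{0<..<z}|lebesgue. f \<xi> y) = (\<integral>y. \<integral>\<xi>. F (\<xi>, y) \<partial>lebesgue \<partial>lebesgue)"
    by (simp add: set_lebesgue_integral_def F_def indicator_times mult.commute flip: integral_scaleR_right)
  then show "(LINT y:{0<..<t}|lebesgue. LINT \<xi>:{0<..<z}|lebesgue. f \<xi> y) = (\<integral>v. h ((z, t) - v) * \<Phi> v \<partial>lborel)"
    using lebesgue_Fubini(2)[OF meas eq int] by simp
qed

section \<open>The two kernels of the equation\<close>

lemma rl_kernel_shift:
  assumes "x > 0"
  shows "rl_kernel (a + of_nat m) x = of_real x powr (a - 1) * of_real x ^ m / Gamma (a + of_nat m)"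
proof -
  have "complex_of_real x powr (a + of_nat m - 1) = of_real x powr ((a - 1) + of_nat m)"
    by (simp add: algebra_simps)
  also have "\<dots> = of_real x powr (a - 1) * of_real x ^ m"
    using assms by (subst powr_add) (simp add: powr_nat')
  finally show ?thesis using assms by (simp add: rl_kernel_def)
qed

lemma konhauser_kernel_eq_0:
  assumes "u \<notin> quadrant"
  shows "konhauser_kernel \<upsilon> x y \<kappa> a b u = 0"
proof -
  have "bi_rl_shift \<upsilon> a b i u = 0" for i
    using assms by (cases i; cases u) (auto simp: bi_rl_shift_def bi_rl_def rl_kernel_def)
  then show ?thesis by (simp add: konhauser_kernel_def)
qed

text \<open>
  Once equal parameters are cancelled, the coefficients of the Mittag-Leffler function are
  those given by \<^const>\<open>konhauser_coeff\<close>. The iterated series agrees with the unordered double sum because of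
  absolute convergence.
\<close>

lemma konhauser_kernel_eq_ML:
  assumes ab: "Re a > 0" "Re b > 0" and \<upsilon>: "\<upsilon> \<ge> 1" and xs: "x > 0" "s > 0"
  shows "of_real x powr (a - 1) * of_real s powr (b - 1) *
      konhauser_ML \<kappa> \<kappa> \<gamma> ((\<kappa> + 1) / 2) \<kappa> \<gamma> a b \<upsilon> (w1 * of_real x) (w2 * of_real s)
    = konhauser_kernel \<upsilon> (-4 * w1) (w2 ^ \<upsilon>) \<kappa> a b (x, s)"
proof -
  define c where "c = complex_of_real x powr (a - 1) * of_real s powr (b - 1)"
  define e where "e = (\<lambda>(l, n). konhauser_ML_coeff \<kappa> \<kappa> \<gamma> ((\<kappa> + 1) / 2) \<kappa> \<gamma> l n *
      (w1 * of_real x) ^ l * (w2 * of_real s) ^ (\<upsilon> * n) /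
      (Gamma (a + of_nat l) * Gamma (b + of_nat (\<upsilon> * n)) * fact n * fact l))"
  have c: "c \<noteq> 0" using xs by (simp add: c_def)
  have e: "konhauser_coeff (-4 * w1) (w2 ^ \<upsilon>) \<kappa> i * bi_rl_shift \<upsilon> a b i (x, s) = c * e i" for i
  proof -
    obtain l n where i: "i = (l, n)" by (cases i)
    show ?thesis
      unfolding i e_def c_def konhauser_coeff_def konhauser_ML_coeff_def bi_rl_shift_def bi_rl_def
        case_prod_conv fst_conv snd_conv rl_kernel_shift[OF xs(1)] rl_kernel_shift[OF xs(2)]
        power_mult_distrib power_mult
      by (simp add: mult_ac del: of_nat_mult)
  qed
  have "((\<lambda>i. c * e i) has_sum konhauser_kernel \<upsilon> (-4 * w1) (w2 ^ \<upsilon>) \<kappa> a b (x, s)) UNIV"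
    using konhauser_has_sum[OF ab \<upsilon>, of "-4 * w1" "w2 ^ \<upsilon>" \<kappa> "(x, s)"] by (simp only: e)
  from has_sum_cmult_right[OF this, of "1 / c"]
  have E: "(e has_sum konhauser_kernel \<upsilon> (-4 * w1) (w2 ^ \<upsilon>) \<kappa> a b (x, s) / c) (UNIV \<times> UNIV)"
    using c by simp
  have "(\<lambda>n. e (l, n)) summable_on UNIV" for l
    by (rule summable_on_SigmaD1[where f = "\<lambda>x y. e (x, y)" and A = UNIV])
       (use E in \<open>auto simp: summable_on_def\<close>)
  then have inner: "((\<lambda>n. e (l, n)) has_sum (\<Sum>n. e (l, n))) UNIV" for l
    using has_sum_infsum has_sum_imp_sums sums_unique by metis
  have "((\<lambda>l. \<Sum>n. e (l, n)) has_sum konhauser_kernel \<upsilon> (-4 * w1) (w2 ^ \<upsilon>) \<kappa> a b (x, s) / c) UNIV"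
    by (rule has_sum_SigmaD[OF E inner])
  then have "(\<Sum>l. \<Sum>n. e (l, n)) = konhauser_kernel \<upsilon> (-4 * w1) (w2 ^ \<upsilon>) \<kappa> a b (x, s) / c"
    using has_sum_imp_sums sums_unique by metis
  then show ?thesis using c by (simp add: konhauser_ML_def e_def c_def)
qed

text \<open>
  For \<open>\<kappa> = - k\<close> the series terminates: \<open>(- k/2)\<^sub>l\<close> vanishes for \<open>l > k/2\<close>, and for the
  other \<open>l\<close> the factor \<open>(l - k)\<^sub>n\<close> vanishes for \<open>n > k - l\<close>. In the polynomial, the duplication formula splits \<open>(- k)\<^bsub>2 l\<^esub>\<close> into
  \<open>4 ^ l (- k/2)\<^sub>l ((1 - k)/2)\<^sub>l\<close>, and the last factor cancels because of the choice
  \<open>\<gamma> = (1 - k)/2\<close>; it is nonzero since \<open>k\<close> is even. Evenness also removes the square root, as only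
  the square of the first argument enters.
\<close>

lemma konhauser_kernel_eq_I:
  assumes k: "even k" and p: "p > real k + 1" and w1: "w1 \<noteq> 0" and xs: "x > 0" "s > 0"
  shows "of_real x powr of_real (p + real k / 2) * of_real s powr of_real q *
      konhauser_I k \<upsilon> p q ((- of_nat k + 1) / 2) (of_real p - of_nat k)
       (1 / (2 * csqrt (w1 * of_real x))) (w2 * of_real s)
    = pochhammer (1 - of_real p) k / w1 ^ (k div 2) *
      konhauser_kernel \<upsilon> (-4 * w1) (w2 ^ \<upsilon>) (- of_nat k) (of_real p + 1) (of_real q + 1) (x, s)"
proof -
  define m where "m = k div 2"
  have km: "k = 2 * m" using k by (simp add: m_def)
  define z where "z = 1 / (2 * csqrt (w1 * of_real x))"
  have wx: "w1 * complex_of_real x \<noteq> 0" using w1 xs by simp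
  have "(2 * z)\<^sup>2 = 1 / (w1 * of_real x)"
    by (simp add: z_def power_divide power2_csqrt)
  then have z2: "4 * z\<^sup>2 = 1 / (w1 * of_real x)" by (simp add: power_mult_distrib)
  have zk: "(- 2 * z) ^ k = 1 / (w1 * of_real x) ^ m"
    by (simp add: km power_mult power_mult_distrib z2 power_divide)
  define I where "I = (SIGMA l:{0..k div 2}. {0..k - l})"
  define c where "c = complex_of_real x powr of_real p * of_real s powr of_real q"
  define e where "e = (\<lambda>(l, n). konhauser_coeff (-4 * w1) (w2 ^ \<upsilon>) (- of_nat k) (l, n) *
      (of_real x ^ l / Gamma (of_real p + 1 + of_nat l)) *
      (of_real s ^ (\<upsilon> * n) / Gamma (of_real q + 1 + of_nat (\<upsilon> * n))))"
  have zero: "konhauser_coeff (-4 * w1) (w2 ^ \<upsilon>) (- of_nat k) i = 0" if "i \<notin> I" for i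
  proof -
    obtain l n where i: "i = (l, n)" by (cases i)
    have "pochhammer (- complex_of_nat m) l = 0 \<or> pochhammer (- of_nat (k - l) :: complex) n = 0"
      using that by (auto simp: i I_def m_def pochhammer_of_nat_eq_0_iff)
    moreover have "- complex_of_nat k / 2 = - of_nat m" by (simp add: km)
    moreover have "- complex_of_nat k + of_nat l = - of_nat (k - l)" if "l \<le> m"
      using that by (simp add: km of_nat_diff)
    moreover have "l \<le> m" if "pochhammer (- complex_of_nat m) l \<noteq> 0"
      using that by (simp add: pochhammer_of_nat_eq_0_iff)
    ultimately show ?thesis unfolding i konhauser_coeff_def case_prod_conv
      by (metis div_0 mult_zero_left mult_zero_right)
  qed
  have "konhauser_kernel \<upsilon> (-4 * w1) (w2 ^ \<upsilon>) (- of_nat k) (of_real p + 1) (of_real q + 1) (x, s)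
      = (\<Sum>\<^sub>\<infinity>i\<in>I. konhauser_coeff (-4 * w1) (w2 ^ \<upsilon>) (- of_nat k) i *
           bi_rl_shift \<upsilon> (of_real p + 1) (of_real q + 1) i (x, s))"
    unfolding konhauser_kernel_def by (rule infsum_cong_neutral) (use zero in auto)
  also have "\<dots> = (\<Sum>i\<in>I. c * e i)"
  proof (subst infsum_finite)
    show "finite I" by (simp add: I_def)
    show "(\<Sum>i\<in>I. konhauser_coeff (-4 * w1) (w2 ^ \<upsilon>) (- of_nat k) i *
           bi_rl_shift \<upsilon> (of_real p + 1) (of_real q + 1) i (x, s)) = (\<Sum>i\<in>I. c * e i)"
      using xs by (intro sum.cong refl)
        (auto simp: e_def c_def bi_rl_shift_def bi_rl_def rl_kernel_shift simp del: of_nat_mult)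
  qed
  also have "\<dots> = c * (\<Sum>l = 0..k div 2. \<Sum>n = 0..k - l. e (l, n))"
    by (simp add: I_def sum.Sigma sum_distrib_left)
  also have "(\<Sum>l = 0..k div 2. \<Sum>n = 0..k - l. e (l, n)) = (\<Sum>l = 0..k div 2. \<Sum>n = 0..k - l.
        ((-1) ^ l * pochhammer (- of_nat k) (2 * l) * pochhammer (- (of_nat k - of_nat l)) n *
         pochhammer (of_real p - of_nat k) l * (1 / (4 * z ^ 2)) ^ l * (w2 * of_real s) ^ (\<upsilon> * n)) /
        (pochhammer (of_real p - of_nat k) l * pochhammer ((- of_nat k + 1) / 2) l *
         Gamma (of_real p + 1 + of_nat l) * Gamma (of_real q + 1 + of_nat (\<upsilon> * n)) *
         fact l * fact n))"
  proof (intro sum.cong refl)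
    fix l n
    have P: "pochhammer (complex_of_real p - of_nat k) l \<noteq> 0"
    proof
      assume "pochhammer (complex_of_real p - of_nat k) l = 0"
      then obtain j where "complex_of_real p - of_nat k = - of_nat j"
        by (auto simp: pochhammer_eq_0_iff)
      then have "p - real k = - real j" by (metis of_real_diff of_real_eq_iff of_real_minus of_real_of_nat_eq)
      with p show False by linarith
    qed
    have H: "pochhammer ((- complex_of_nat k + 1) / 2) l \<noteq> 0"
    proof
      assume "pochhammer ((- complex_of_nat k + 1) / 2) l = 0"
      then obtain j where "(- complex_of_nat k + 1) / 2 = - of_nat j"
        by (auto simp: pochhammer_eq_0_iff)
      then have "complex_of_nat (2 * j + 1) = of_nat k" by (simp add: field_simps add_eq_0_iff)
      then have "2 * j + 1 = k" by (simp only: of_nat_eq_iff)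
      with k show False by auto
    qed
    have D: "pochhammer (- complex_of_nat k) (2 * l) =
        4 ^ l * pochhammer (- of_nat k / 2) l * pochhammer ((- of_nat k + 1) / 2) l"
    proof -
      have "2 * (- complex_of_nat k / 2) = - of_nat k"
        "(- complex_of_nat k + 1) / 2 = - of_nat k / 2 + 1 / 2"
        by (simp_all add: add_divide_distrib)
      then show ?thesis
        using pochhammer_double[of "- complex_of_nat k / 2" l] by (simp only:) (simp add: power_mult)
    qed
    have Z: "1 / (4 * z\<^sup>2) = w1 * of_real x" unfolding z2 by simp
    have "(-4 * w1) ^ l = (-1) ^ l * 4 ^ l * w1 ^ l"
      by (simp flip: power_mult_distrib)
    moreover have "- complex_of_nat k + of_nat l = - (of_nat k - of_nat l)" by simp
    ultimately show "e (l, n) = 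
        ((-1) ^ l * pochhammer (- of_nat k) (2 * l) * pochhammer (- (of_nat k - of_nat l)) n *
         pochhammer (of_real p - of_nat k) l * (1 / (4 * z ^ 2)) ^ l * (w2 * of_real s) ^ (\<upsilon> * n)) /
        (pochhammer (of_real p - of_nat k) l * pochhammer ((- of_nat k + 1) / 2) l *
         Gamma (of_real p + 1 + of_nat l) * Gamma (of_real q + 1 + of_nat (\<upsilon> * n)) *
         fact l * fact n)"
      unfolding e_def konhauser_coeff_def case_prod_conv D Z using P H
      by (simp add: power_mult_distrib power_mult del: of_nat_mult) (simp add: mult_ac del: of_nat_mult)
  qed
  finally have K: "konhauser_kernel \<upsilon> (-4 * w1) (w2 ^ \<upsilon>) (- of_nat k) (of_real p + 1) (of_real q + 1) (x, s)
     * (pochhammer (1 - of_real p) k * (- 2 * z) ^ k) = c *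
      konhauser_I k \<upsilon> p q ((- of_nat k + 1) / 2) (of_real p - of_nat k) z (w2 * of_real s)"
    by (simp only: konhauser_I_def mult_ac)
  have "complex_of_real x powr of_real (p + real k / 2) = of_real x powr of_real p * of_real x ^ m"
    using xs by (simp add: km powr_add powr_nat')
  then have "of_real x powr of_real (p + real k / 2) * of_real s powr of_real q *
      konhauser_I k \<upsilon> p q ((- of_nat k + 1) / 2) (of_real p - of_nat k) z (w2 * of_real s)
    = of_real x ^ m * (c * konhauser_I k \<upsilon> p q ((- of_nat k + 1) / 2) (of_real p - of_nat k) z (w2 * of_real s))"
    by (simp only: c_def mult_ac)
  also have "\<dots> = of_real x ^ m * (konhauser_kernel \<upsilon> (-4 * w1) (w2 ^ \<upsilon>) (- of_nat k) (of_real p + 1) (of_real q + 1) (x, s)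
     * (pochhammer (1 - of_real p) k * (1 / (w1 * of_real x) ^ m)))"
    unfolding K[symmetric] zk ..
  also have "\<dots> = pochhammer (1 - of_real p) k / w1 ^ m *
      konhauser_kernel \<upsilon> (-4 * w1) (w2 ^ \<upsilon>) (- of_nat k) (of_real p + 1) (of_real q + 1) (x, s)"
    using xs w1 by (simp add: power_mult_distrib)
  finally show ?thesis by (simp only: z_def m_def)
qed

text \<open>
  The finiteness required by \<open>convolution_assoc\<close>: convolving the two majorants gives a
  constant times the majorant of order \<open>(a + a', b + b')\<close>, which is assumed to be integrable
  against \<open>G\<close>. The bounds are needed only below \<open>u\<close>, since all functions live on the quadrant.
\<close>

lemma dominated_convolution_finite:
  fixes h1 h2 G :: "real \<times> real \<Rightarrow> complex"
  assumes [measurable]: "h1 \<in> borel_measurable borel" "h2 \<in> borel_measurable borel" "G \<in> borel_measurable borel"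
    and ab: "a > 0" "b > 0" "a' > 0" "b' > 0"
    and 0: "\<And>v. v \<notin> quadrant \<Longrightarrow> h1 v = 0" "\<And>v. v \<notin> quadrant \<Longrightarrow> h2 v = 0" "\<And>v. v \<notin> quadrant \<Longrightarrow> G v = 0"
    and M: "M1 \<ge> 0" "M2 \<ge> 0"
    and h1: "\<And>v. fst v \<le> fst u \<Longrightarrow> snd v \<le> snd u \<Longrightarrow> norm (h1 v) \<le> M1 * bi_pos a b v"
    and h2: "\<And>v. fst v \<le> fst u \<Longrightarrow> snd v \<le> snd u \<Longrightarrow> norm (h2 v) \<le> M2 * bi_pos a' b' v"
    and int: "integrable lborel (\<lambda>w. bi_pos (a + a') (b + b') (u - w) * norm (G w))"
  shows "(\<integral>\<^sup>+w. (\<integral>\<^sup>+v. ennreal (norm (h1 (u - v)) * norm (h2 (v - w))) \<partial>lborel) * ennreal (norm (G w)) \<partial>lborel) < \<infinity>"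
proof -
  define B where "B = Beta a a' * Beta b b'"
  have B: "B \<ge> 0" using ab by (simp add: B_def Beta_def Gamma_real_pos less_imp_le)
  have "(\<integral>\<^sup>+v. ennreal (norm (h1 (u - v)) * norm (h2 (v - w))) \<partial>lborel) * ennreal (norm (G w))
      \<le> ennreal (M1 * M2 * B) * ennreal (bi_pos (a + a') (b + b') (u - w) * norm (G w))" for w
  proof (cases "w \<in> quadrant")
    case False
    then show ?thesis using 0 by simp
  next
    case True
    have pt: "norm (h1 (u - v)) * norm (h2 (v - w)) \<le> M1 * M2 * (bi_pos a b (u - v) * bi_pos a' b' (v - w))" for v
    proof (cases "u - v \<in> quadrant \<and> v - w \<in> quadrant")
      case False
      then have "norm (h1 (u - v)) * norm (h2 (v - w)) = 0" using 0 by (metis mult_eq_0_iff norm_zero)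
      also have "0 \<le> M1 * M2 * (bi_pos a b (u - v) * bi_pos a' b' (v - w))" using M by simp
      finally show ?thesis .
    next
      case uv: True
      have "norm (h1 (u - v)) \<le> M1 * bi_pos a b (u - v)"
        using uv True by (intro h1) (cases u; cases v; cases w; auto)+
      moreover have "norm (h2 (v - w)) \<le> M2 * bi_pos a' b' (v - w)"
        using uv True by (intro h2) (cases u; cases v; cases w; auto)+
      ultimately have "norm (h1 (u - v)) * norm (h2 (v - w)) \<le>
          (M1 * bi_pos a b (u - v)) * (M2 * bi_pos a' b' (v - w))"
        using M by (intro mult_mono) auto
      then show ?thesis by (simp add: mult_ac)
    qed
    have "(\<integral>\<^sup>+v. ennreal (norm (h1 (u - v)) * norm (h2 (v - w))) \<partial>lborel)
       \<le> (\<integral>\<^sup>+v. ennreal (M1 * M2) * ennreal (bi_pos a b (u - v) * bi_pos a' b' (v - w)) \<partial>lborel)"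
      using pt M by (intro nn_integral_mono) (simp flip: ennreal_mult)
    also have "\<dots> = ennreal (M1 * M2) * (\<integral>\<^sup>+v. ennreal (bi_pos a b (u - v) * bi_pos a' b' (v - w)) \<partial>lborel)"
      by (rule nn_integral_cmult) measurable
    also have "(\<integral>\<^sup>+v. ennreal (bi_pos a b (u - v) * bi_pos a' b' (v - w)) \<partial>lborel)
       = (\<integral>\<^sup>+v. ennreal (bi_pos a b (u - w - v) * bi_pos a' b' v) \<partial>lborel)"
      using nn_integral_lborel_translate[of "\<lambda>v. ennreal (bi_pos a b (u - w - v) * bi_pos a' b' v)" w]
      by simp
    also have "\<dots> = ennreal (B * bi_pos (a + a') (b + b') (u - w))"
      unfolding B_def by (rule nn_integral_bi_pos_convolution[OF ab])
    also have "ennreal (M1 * M2) * ennreal (B * bi_pos (a + a') (b + b') (u - w)) * ennreal (norm (G w))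
       = ennreal (M1 * M2 * B) * ennreal (bi_pos (a + a') (b + b') (u - w) * norm (G w))"
      using M B by (simp add: mult_ac flip: ennreal_mult)
    finally show ?thesis by (simp add: mult_right_mono)
  qed
  then have "(\<integral>\<^sup>+w. (\<integral>\<^sup>+v. ennreal (norm (h1 (u - v)) * norm (h2 (v - w))) \<partial>lborel) * ennreal (norm (G w)) \<partial>lborel)
    \<le> (\<integral>\<^sup>+w. ennreal (M1 * M2 * B) * ennreal (bi_pos (a + a') (b + b') (u - w) * norm (G w)) \<partial>lborel)"
    by (rule nn_integral_mono)
  also have "\<dots> = ennreal (M1 * M2 * B) * (\<integral>\<^sup>+w. ennreal (bi_pos (a + a') (b + b') (u - w) * norm (G w)) \<partial>lborel)"
    by (rule nn_integral_cmult) measurable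
  also have "\<dots> < \<infinity>"
    using int by (subst nn_integral_eq_integral) (auto simp: ennreal_mult_less_top)
  finally show ?thesis .
qed

text \<open>
  Integrability on all rectangles \<open>(0, n) \<times> (0, n)\<close> makes \<open>g\<close> measurable on the quadrant, as a
  pointwise limit of truncations.
\<close>

lemma quadrant_borel_representative:
  fixes g :: "real \<Rightarrow> real \<Rightarrow> complex"
  assumes "\<And>z t. z > 0 \<Longrightarrow> t > 0 \<Longrightarrow> (\<lambda>(\<xi>, y). g \<xi> y) absolutely_integrable_on {0<..<z} \<times> {0<..<t}"
  obtains G where "G \<in> borel_measurable borel" "\<And>v. v \<notin> quadrant \<Longrightarrow> G v = 0"
    "AE v in lborel. v \<in> quadrant \<longrightarrow> g (fst v) (snd v) = G v"
proof -
  define f where "f n v = indicator ({0<..<real (Suc n)} \<times> {0<..<real (Suc n)}) v *\<^sub>R g (fst v) (snd v)" for n v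
  define g0 where "g0 v = (if v \<in> quadrant then g (fst v) (snd v) else 0)" for v
  have "f n \<in> borel_measurable lebesgue" for n
    using assms[of "real (Suc n)" "real (Suc n)"]
    by (auto simp: set_integrable_def f_def[abs_def] case_prod_unfold)
  moreover have "(\<lambda>n. f n v) \<longlonglongrightarrow> g0 v" for v
  proof (rule tendsto_eventually)
    obtain N :: nat where N: "max (fst v) (snd v) < real N" using reals_Archimedean2 by blast
    show "eventually (\<lambda>n. f n v = g0 v) sequentially"
      using eventually_ge_at_top[of N]
      by eventually_elim (use N in \<open>cases v; auto simp: f_def g0_def indicator_def\<close>)
  qed
  ultimately have "g0 \<in> borel_measurable lebesgue"
    by (rule borel_measurable_LIMSEQ_metric)
  then obtain G where [measurable]: "G \<in> borel_measurable borel" and G: "AE v in lborel. g0 v = G v"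
    by (rule lebesgue_borel_representative)
  have [measurable]: "quadrant \<in> sets borel"
    by (intro borel_open open_Times) auto
  show ?thesis
  proof
    show "(\<lambda>v. if v \<in> quadrant then G v else 0) \<in> borel_measurable borel" 
      by (rule measurable_If_set) auto
    show "AE v in lborel. v \<in> quadrant \<longrightarrow> g (fst v) (snd v) = (if v \<in> quadrant then G v else 0)"
      using G by eventually_elim (metis g0_def)
  qed auto
qed

section \<open>Solution of the equation\<close>

theorem theorem54:
  fixes k \<upsilon> :: nat and p q :: real and w1 w2 \<gamma>3 \<sigma> \<tau> :: complex
    and \<psi> g d :: "real \<Rightarrow> real \<Rightarrow> complex"
  assumes "even k" and "\<upsilon> \<ge> 1" and "p > real k + 1" and "q > -1" and "w1 \<noteq> 0"
    and "Re (\<sigma> - of_real p - 1) > 0" and "Re (\<tau> - of_real q - 1) > 0"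
    and inverse: "is_RL2_inverse \<sigma> \<tau> \<psi> g"
    and integrable: "\<And>z t. z > 0 \<Longrightarrow> t > 0 \<Longrightarrow>
          (\<lambda>(\<xi>, y). g \<xi> y) absolutely_integrable_on {0<..<z} \<times> {0<..<t}"
    and d: "\<And>z t. z > 0 \<Longrightarrow> t > 0 \<Longrightarrow>
          d z t = (-1) ^ k / pochhammer (1 - of_real p) k *
            (LINT \<xi>:{0<..<z}|lebesgue. LINT y:{0<..<t}|lebesgue.
               solution_integrand k \<upsilon> p q w1 w2 \<gamma>3 \<sigma> \<tau> g z t \<xi> y)"
  shows "(AE (z, t) in lebesgue. z > 0 \<longrightarrow> t > 0 \<longrightarrow>
            (\<lambda>(\<xi>, y). solution_integrand k \<upsilon> p q w1 w2 \<gamma>3 \<sigma> \<tau> g z t \<xi> y)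
              absolutely_integrable_on {0<..<z} \<times> {0<..<t}) \<and>
         solves_conv_equation k \<upsilon> p q w1 w2 \<psi> d"
proof -
  define a b a' b' :: complex where "a = of_real p + 1" and "b = of_real q + 1"
    and "a' = \<sigma> - of_real p - 1" and "b' = \<tau> - of_real q - 1"
  define c where "c = pochhammer (1 - complex_of_real p) k"
  define K1 where "K1 = konhauser_kernel \<upsilon> (-4 * w1) (w2 ^ \<upsilon>) (- of_nat k) a b"
  define K2 where "K2 = konhauser_kernel \<upsilon> (-4 * w1) (w2 ^ \<upsilon>) (of_nat k) a' b'"
  have ab: "Re a > 0" "Re b > 0" and ab': "Re a' > 0" "Re b' > 0"
    using assms(3,4,6,7) by (auto simp: a_def b_def a'_def b'_def)
  have \<sigma>: "a + a' = \<sigma>" "b + b' = \<tau>" by (simp_all add: a_def b_def a'_def b'_def)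
  have \<sigma>0: "Re \<sigma> > 0" "Re \<tau> > 0" using ab ab' by (simp_all flip: \<sigma>)
  have c: "c \<noteq> 0"
  proof
    assume "c = 0"
    then obtain j where "j < k" "1 - complex_of_real p = - of_nat j"
      by (auto simp: c_def pochhammer_eq_0_iff)
    then have "1 - p = - real j" by (metis of_real_1 of_real_diff of_real_eq_iff of_real_minus of_real_of_nat_eq)
    with \<open>j < k\<close> assms(3) show False by linarith
  qed
  have [measurable]: "K1 \<in> borel_measurable borel" "K2 \<in> borel_measurable borel"
    using ab ab' \<open>\<upsilon> \<ge> 1\<close> by (auto simp: K1_def K2_def intro!: konhauser_kernel_measurable)
  have K0: "K1 v = 0" "K2 v = 0" "bi_rl \<sigma> \<tau> v = 0" if "v \<notin> quadrant" for v
    using that konhauser_kernel_eq_0[OF that]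
    by (auto simp: K1_def K2_def bi_rl_def rl_kernel_def mem_Times_iff)
  \<comment> \<open>the heart of the proof: the parameters \<open>- k\<close> and \<open>k\<close> cancel\<close>
  have K12: "(\<integral>v. K1 (u - v) * K2 v \<partial>lborel) = bi_rl \<sigma> \<tau> u" for u
    using konhauser_kernel_convolution[OF ab ab' \<open>\<upsilon> \<ge> 1\<close>, of "-4 * w1" "w2 ^ \<upsilon>" "- of_nat k" u "of_nat k"]
    by (simp add: K1_def K2_def \<sigma> konhauser_kernel_0)
  obtain G where [measurable]: "G \<in> borel_measurable borel" and G0: "\<And>v. v \<notin> quadrant \<Longrightarrow> G v = 0"
    and G: "AE v in lborel. v \<in> quadrant \<longrightarrow> g (fst v) (snd v) = G v"
    using quadrant_borel_representative[OF integrable] by blast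

  \<comment> \<open>the hypothesis on \<open>\<psi>\<close> says that \<open>\<psi>\<close> is the convolution of \<open>G\<close> with the kernel of order \<open>(\<sigma>, \<tau>)\<close>\<close>
  have RL2: "integrable lborel (\<lambda>v. bi_rl \<sigma> \<tau> ((z, t) - v) * G v)"
    "(\<integral>v. bi_rl \<sigma> \<tau> ((z, t) - v) * G v \<partial>lborel) = \<psi> z t" if zt: "z > 0" "t > 0" for z t
  proof -
    define \<Gamma> where "\<Gamma> = Gamma \<sigma> * Gamma \<tau>"
    have \<Gamma>: "\<Gamma> \<noteq> 0" using \<sigma>0 by (simp add: \<Gamma>_def Gamma_nonzero_Re_pos)
    have eq: "RL2_integrand \<sigma> \<tau> g z t \<xi> y = (\<Gamma> * bi_rl \<sigma> \<tau> (z - \<xi>, t - y)) * g \<xi> y"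
      if "0 < \<xi>" "\<xi> < z" "0 < y" "y < t" for \<xi> y
      using that \<Gamma> by (simp add: RL2_integrand_def bi_rl_def rl_kernel_def \<Gamma>_def)
    have h: "integrable lborel (\<lambda>v. (\<Gamma> * bi_rl \<sigma> \<tau> ((z, t) - v)) * G v)"
      using inverse zt unfolding is_RL2_inverse_def
      by (subst quadrant_convolution(1)[where f = "RL2_integrand \<sigma> \<tau> g z t", OF _ _ _ G0 G eq, symmetric])
         (auto simp: K0)
    have "(LINT y:{0<..<t}|lebesgue. LINT \<xi>:{0<..<z}|lebesgue. RL2_integrand \<sigma> \<tau> g z t \<xi> y)
       = (\<integral>v. (\<Gamma> * bi_rl \<sigma> \<tau> ((z, t) - v)) * G v \<partial>lborel)"
      by (rule quadrant_convolution(3)[OF _ _ _ G0 G eq h]) (auto simp: K0)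
    also have "\<dots> = \<Gamma> * (\<integral>v. bi_rl \<sigma> \<tau> ((z, t) - v) * G v \<partial>lborel)"
      by (simp add: mult.assoc)
    finally have "RL2 \<sigma> \<tau> g z t = (\<integral>v. bi_rl \<sigma> \<tau> ((z, t) - v) * G v \<partial>lborel)"
      using \<Gamma> by (simp add: RL2_def flip: \<Gamma>_def)
    then show "(\<integral>v. bi_rl \<sigma> \<tau> ((z, t) - v) * G v \<partial>lborel) = \<psi> z t"
      using inverse zt by (simp add: is_RL2_inverse_def)
    show "integrable lborel (\<lambda>v. bi_rl \<sigma> \<tau> ((z, t) - v) * G v)"
      using integrable_mult_right[of "1 / \<Gamma>", OF h] \<Gamma> by (simp add: mult.assoc)
  qed

  \<comment> \<open>the majorants of the two kernels convolve to a multiple of \<open>norm (bi_rl \<sigma> \<tau>)\<close>\<close>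
  have fin: "(\<integral>\<^sup>+w. (\<integral>\<^sup>+v. ennreal (norm (h ((z, t) - v)) * norm (K2 (v - w))) \<partial>lborel) * ennreal (norm (G w)) \<partial>lborel) < \<infinity>"
    if zt: "z > 0" "t > 0" and [measurable]: "h \<in> borel_measurable borel"
      and h0: "\<And>v. v \<notin> quadrant \<Longrightarrow> h v = 0"
      and M: "M \<ge> 0" "\<And>v. fst v \<le> z \<Longrightarrow> snd v \<le> t \<Longrightarrow> norm (h v) \<le> M * bi_pos (Re a) (Re b) v"
    for z t M and h :: "real \<times> real \<Rightarrow> complex"
  proof -
    obtain M' where M': "M' \<ge> 0" "\<And>v. fst v \<le> z \<Longrightarrow> snd v \<le> t \<Longrightarrow> norm (K2 v) \<le> M' * bi_pos (Re a') (Re b') v"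
      using konhauser_kernel_bound[OF ab' \<open>\<upsilon> \<ge> 1\<close>, of z t] zt unfolding K2_def by (metis less_imp_le)
    have "bi_pos (Re \<sigma>) (Re \<tau>) v = norm (Gamma \<sigma> * Gamma \<tau>) * norm (bi_rl \<sigma> \<tau> v)" for v
      using \<sigma>0 Gamma_nonzero_Re_pos by (simp add: bi_pos_def bi_rl_def norm_mult norm_rl_kernel)
    then have "integrable lborel (\<lambda>w. bi_pos (Re \<sigma>) (Re \<tau>) ((z, t) - w) * norm (G w))"
      using integrable_mult_right[of "norm (Gamma \<sigma> * Gamma \<tau>)", OF integrable_norm[OF RL2(1)[OF zt]]]
      by (simp add: norm_mult mult_ac)
    moreover have "Re \<sigma> = Re a + Re a'" "Re \<tau> = Re b + Re b'" by (simp_all flip: \<sigma>)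
    ultimately show ?thesis
      by (intro dominated_convolution_finite[OF _ _ _ ab ab' h0 K0(2) G0 M(1) M'(1)])
         (use M M' in auto)
  qed

  \<comment> \<open>\<open>K1\<close> may have zeros, so convergence almost everywhere is obtained from its majorant \<open>P\<close>, which has none in the quadrant\<close>
  have existence: "AE v in lborel. v \<in> quadrant \<longrightarrow> integrable lborel (\<lambda>w. K2 (v - w) * G w)"
  proof -
    define P where "P v = complex_of_real (bi_pos (Re a) (Re b) v)" for v
    have [measurable]: "P \<in> borel_measurable borel" unfolding P_def by measurable
    have P0: "P v = 0" if "v \<notin> quadrant" for v
      using that by (auto simp: P_def bi_pos_def pos_powr_def mem_Times_iff)
    have Ppos: "P v \<noteq> 0" if "v \<in> quadrant" for v
      using that by (auto simp: P_def bi_pos_def pos_powr_def mem_Times_iff)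
    have "AE v in lborel. integrable lborel (\<lambda>w. P ((real (Suc n), real (Suc n)) - v) * (K2 (v - w) * G w))" for n
      by (rule convolution_assoc(1)[OF _ _ _ fin[where M = 1]]) (auto simp: P0, auto simp: P_def)
    then have "AE v in lborel. \<forall>n. integrable lborel (\<lambda>w. P ((real (Suc n), real (Suc n)) - v) * (K2 (v - w) * G w))"
      by (simp add: AE_all_countable)
    then show ?thesis
    proof eventually_elim
      fix v :: "real \<times> real"
      assume *: "\<forall>n. integrable lborel (\<lambda>w. P ((real (Suc n), real (Suc n)) - v) * (K2 (v - w) * G w))"
      \<comment> \<open>any point of the diagonal strictly above \<open>v\<close> in both coordinates serves\<close>
      obtain n :: nat where "max (fst v) (snd v) < real n" using reals_Archimedean2 by blast
      then have "P ((real (Suc n), real (Suc n)) - v) \<noteq> 0" by (intro Ppos) (auto simp: mem_Times_iff)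
      then show "v \<in> quadrant \<longrightarrow> integrable lborel (\<lambda>w. K2 (v - w) * G w)"
        using integrable_mult_right[OF *[rule_format, of n], of "1 / P ((real (Suc n), real (Suc n)) - v)"] by simp
    qed
  qed

  have sol: "solution_integrand k \<upsilon> p q w1 w2 \<gamma>3 \<sigma> \<tau> g z t \<xi> y = K2 (z - \<xi>, t - y) * g \<xi> y"
    if "0 < \<xi>" "\<xi> < z" "0 < y" "y < t" for z t \<xi> y
  proof -
    have exps: "\<sigma> - of_real p - 2 = a' - 1" "\<tau> - of_real q - 2 = b' - 1"
      by (simp_all add: a'_def b'_def)
    have "z - \<xi> > 0" "t - y > 0" using that by simp_all
    from konhauser_kernel_eq_ML[OF ab' \<open>\<upsilon> \<ge> 1\<close> this, of "of_nat k" \<gamma>3 w1 w2] show ?thesis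
      by (simp only: solution_integrand_def K2_def exps a'_def [symmetric] b'_def [symmetric])
  qed

  have sol_iff: "(\<lambda>(\<xi>, y). solution_integrand k \<upsilon> p q w1 w2 \<gamma>3 \<sigma> \<tau> g z t \<xi> y)
              absolutely_integrable_on {0<..<z} \<times> {0<..<t}
      \<longleftrightarrow> integrable lborel (\<lambda>w. K2 ((z, t) - w) * G w)" for z t
    by (rule quadrant_convolution(1)[OF _ _ _ G0 G sol]) (auto simp: K0)

  have part1: "AE (z, t) in lebesgue. z > 0 \<longrightarrow> t > 0 \<longrightarrow>
            (\<lambda>(\<xi>, y). solution_integrand k \<upsilon> p q w1 w2 \<gamma>3 \<sigma> \<tau> g z t \<xi> y)
              absolutely_integrable_on {0<..<z} \<times> {0<..<t}"
    unfolding sol_iff AE_completion_iff using existence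
    by eventually_elim (auto simp: case_prod_unfold mem_Times_iff)

  define D where "D v = (\<integral>w. K2 (v - w) * G w \<partial>lborel) / c" for v
  have [measurable]: "D \<in> borel_measurable borel"
    unfolding D_def by measurable
  have D0: "D v = 0" if "v \<notin> quadrant" for v
  proof -
    have "K2 (v - w) * G w = 0" for w
    proof (cases "w \<in> quadrant")
      case True
      then have "v - w \<notin> quadrant" using that by (auto simp: mem_Times_iff)
      then show ?thesis by (simp add: K0)
    qed (simp add: G0)
    then show ?thesis unfolding D_def by (simp only:) simp
  qed
  \<comment> \<open>\<open>d\<close> may differ from \<open>D\<close> where the convolution diverges, which is a null set\<close>
  have D: "AE v in lborel. v \<in> quadrant \<longrightarrow> d (fst v) (snd v) = D v"
    using existence
  proof eventually_elim
    fix v :: "real \<times> real"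
    assume v: "v \<in> quadrant \<longrightarrow> integrable lborel (\<lambda>w. K2 (v - w) * G w)"
    show "v \<in> quadrant \<longrightarrow> d (fst v) (snd v) = D v"
    proof
      assume vq: "v \<in> quadrant"
      obtain z t where vzt: "v = (z, t)" by (cases v)
      have "integrable lborel (\<lambda>w. K2 ((z, t) - w) * G w)" using v vq vzt by simp
      then have "(LINT \<xi>:{0<..<z}|lebesgue. LINT y:{0<..<t}|lebesgue.
               solution_integrand k \<upsilon> p q w1 w2 \<gamma>3 \<sigma> \<tau> g z t \<xi> y) = (\<integral>w. K2 ((z, t) - w) * G w \<partial>lborel)"
        by (intro quadrant_convolution(2)[OF _ _ _ G0 G sol]) (auto simp: K0)
      then show "d (fst v) (snd v) = D v"
        using d[of z t] vq \<open>even k\<close> by (simp add: vzt D_def c_def)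
    qed
  qed

  have "(\<lambda>(\<xi>, y). conv_integrand k \<upsilon> p q w1 w2 d z t \<xi> y)
          absolutely_integrable_on {0<..<z} \<times> {0<..<t} \<and>
        \<psi> z t = w1 ^ (k div 2) *
          (LINT \<xi>:{0<..<z}|lebesgue. LINT y:{0<..<t}|lebesgue.
             conv_integrand k \<upsilon> p q w1 w2 d z t \<xi> y)" if zt: "z > 0" "t > 0" for z t
  proof -
    define C where "C = c / w1 ^ (k div 2)"
    have eq: "conv_integrand k \<upsilon> p q w1 w2 d z t \<xi> y = (C * K1 (z - \<xi>, t - y)) * d \<xi> y"
      if "0 < \<xi>" "\<xi> < z" "0 < y" "y < t" for \<xi> y
      using konhauser_kernel_eq_I[OF \<open>even k\<close> assms(3) \<open>w1 \<noteq> 0\<close>, of "z - \<xi>" "t - y" q \<upsilon> w2] that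
      by (simp add: conv_integrand_def K1_def C_def c_def a_def b_def mult_ac)
    obtain M where M: "M \<ge> 0" "\<And>v. fst v \<le> z \<Longrightarrow> snd v \<le> t \<Longrightarrow> norm (K1 v) \<le> M * bi_pos (Re a) (Re b) v"
      using konhauser_kernel_bound[OF ab \<open>\<upsilon> \<ge> 1\<close>, of z t] zt unfolding K1_def by (metis less_imp_le)
    have fin1: "(\<integral>\<^sup>+w. (\<integral>\<^sup>+v. ennreal (norm (K1 ((z, t) - v)) * norm (K2 (v - w))) \<partial>lborel) * ennreal (norm (G w)) \<partial>lborel) < \<infinity>"
      by (rule fin[OF zt _ K0(1) M]) auto
    have assoc: "integrable lborel (\<lambda>v. K1 ((z, t) - v) * (\<integral>w. K2 (v - w) * G w \<partial>lborel))"
      "(\<integral>v. K1 ((z, t) - v) * (\<integral>w. K2 (v - w) * G w \<partial>lborel) \<partial>lborel) = \<psi> z t"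
      using convolution_assoc(2,3)[OF _ _ _ fin1] RL2(2)[OF zt] by (simp_all add: K12)
    have int: "integrable lborel (\<lambda>v. (C * K1 ((z, t) - v)) * D v)"
      using integrable_mult_right[of "C / c", OF assoc(1)] by (simp add: D_def mult_ac)
    have "(\<lambda>(\<xi>, y). conv_integrand k \<upsilon> p q w1 w2 d z t \<xi> y)
          absolutely_integrable_on {0<..<z} \<times> {0<..<t}"
      by (subst quadrant_convolution(1)[OF _ _ _ D0 D eq]) (use int in \<open>auto simp: K0\<close>)
    moreover have "(LINT \<xi>:{0<..<z}|lebesgue. LINT y:{0<..<t}|lebesgue.
             conv_integrand k \<upsilon> p q w1 w2 d z t \<xi> y) = (\<integral>v. (C * K1 ((z, t) - v)) * D v \<partial>lborel)"
      by (rule quadrant_convolution(2)[OF _ _ _ D0 D eq int]) (auto simp: K0)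
    moreover have "(\<integral>v. (C * K1 ((z, t) - v)) * D v \<partial>lborel) = C / c * \<psi> z t"
    proof -
      have "(\<integral>v. (C * K1 ((z, t) - v)) * D v \<partial>lborel) =
          (\<integral>v. C / c * (K1 ((z, t) - v) * (\<integral>w. K2 (v - w) * G w \<partial>lborel)) \<partial>lborel)"
        by (intro Bochner_Integration.integral_cong refl) (simp add: D_def)
      also have "\<dots> = C / c * (\<integral>v. K1 ((z, t) - v) * (\<integral>w. K2 (v - w) * G w \<partial>lborel) \<partial>lborel)"
        by (rule integral_mult_right_zero)
      finally show ?thesis by (simp only: assoc(2))
    qed
    ultimately show ?thesis using c \<open>w1 \<noteq> 0\<close> by (simp add: C_def)
  qed
  then have "solves_conv_equation k \<upsilon> p q w1 w2 \<psi> d"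
    by (simp add: solves_conv_equation_def)
  with part1 show ?thesis by blast
qed

end
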